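(* Let $G$ be a finite $p$-group such that $\mathrm{Aut}(G)$ is elementary abelian, where $p$ is an odd prime. Then one of the following two conditions holds true: (1) $Z(G) = \Phi(G)$ is elementary abelian; (2) $\gamma_2(G) = \Phi(G)$ is elementary abelian. Moreover, the exponent of $G$ is $p^2$.
   Context: For a finite group $G$, $\gamma_2(G)$, $Z(G)$ and $\Phi(G)$ denote the commutator subgroup, the center and the Frattini subgroup of $G$, respectively, and $\mathrm{Aut}(G)$ denotes the group of all automorphisms of $G$.
   Formalization: The claim that the exponent of G is p^2 is stated only for G not of order 1 or 3: the trivial group (exponent 1) and the cyclic group of order 3 (automorphism group of order 2, exponent 3) satisfy the hypotheses but violate it. *)

theory Defs
  imports "HOL-Algebra.Algebra" "HOL-Algebra.Bij" "HOL-Computational_Algebra.Primes"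
begin

definition center :: "('a, 'b) monoid_scheme \<Rightarrow> 'a set" where
  "center G = {z \<in> carrier G. \<forall>x \<in> carrier G. z \<otimes>\<^bsub>G\<^esub> x = x \<otimes>\<^bsub>G\<^esub> z}"

definition maximal_subgroup :: "'a set \<Rightarrow> ('a, 'b) monoid_scheme \<Rightarrow> bool" where
  "maximal_subgroup M G \<longleftrightarrow> subgroup M G \<and> M \<noteq> carrier G \<and>
     (\<forall>H. subgroup H G \<longrightarrow> M \<subseteq> H \<longrightarrow> H = M \<or> H = carrier G)"

(* Intersecting with the carrier makes this the whole group when there are no maximal subgroups. *)
definition frattini :: "('a, 'b) monoid_scheme \<Rightarrow> 'a set" where
  "frattini G = carrier G \<inter> \<Inter>{M. maximal_subgroup M G}"

(* The prime is not fixed in advance, and the trivial group counts as elementary abelian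
   (of rank 0). *)
definition elementary_abelian :: "('a, 'b) monoid_scheme \<Rightarrow> bool" where
  "elementary_abelian G \<longleftrightarrow> comm_group G \<and>
     (\<exists>q::nat. Factorial_Ring.prime q \<and> (\<forall>x \<in> carrier G. x [^]\<^bsub>G\<^esub> q = \<one>\<^bsub>G\<^esub>))"

(* Only meaningful for groups of finite exponent; in particular for finite groups. *)
definition group_exponent :: "('a, 'b) monoid_scheme \<Rightarrow> nat" where
  "group_exponent G = (LEAST e. 0 < e \<and> (\<forall>x \<in> carrier G. x [^]\<^bsub>G\<^esub> e = \<one>\<^bsub>G\<^esub>))"

definition finite_p_group :: "nat \<Rightarrow> ('a, 'b) monoid_scheme \<Rightarrow> bool" where
  "finite_p_group p G \<longleftrightarrow> group G \<and> finite (carrier G) \<and> (\<exists>n. order G = p ^ n)"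

end

theory Submission
  imports Defs
begin

text \<open>If \<open>G\<close> is abelian, inversion shows that \<open>Aut(G)\<close> has exponent 2; then \<open>x \<mapsto> x\<^sup>2\<close> has order at most 2,
  so \<open>G\<close> has exponent dividing 3, and a transvection of order 3 excludes \<open>|G| > 3\<close>.

  If \<open>G\<close> is not abelian, inner automorphisms show that \<open>Aut(G)\<close> has exponent \<open>p\<close> and that \<open>G\<close> has
  class 2 with central \<open>p\<close>-th powers. Hence \<open>x \<mapsto> x\<^sup>p\<close> is an endomorphism and \<open>\<Phi>(G)\<close> consists of the
  products of a \<open>p\<close>-th power and an element of \<open>\<gamma>\<^sub>2(G)\<close>.
  The automorphism \<open>x \<mapsto> x\<^sup>1\<^sup>+\<^sup>p\<close> has order dividing \<open>p\<close>, so the exponent of \<open>G\<close> divides \<open>p\<^sup>2\<close>. If it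
  were \<open>p\<close>, one could extend the identity of \<open>Z(G)\<close> to an automorphism inverting \<open>G/Z(G)\<close>, of order 2.
  Commuting with automorphisms \<open>t \<mapsto> tc\<close> that fix a maximal subgroup containing \<open>Z(G)\<close> forces every
  automorphism \<open>x \<mapsto> x g(x)\<close> with central values of \<open>g\<close> to satisfy \<open>g(c) = 1\<close> for all central \<open>c\<close> with
  \<open>c\<^sup>p = 1\<close>. If some \<open>x\<^sub>0\<^sup>p\<close> lies outside \<open>\<gamma>\<^sub>2(G)\<close> and some central \<open>w\<close> has order \<open>p\<^sup>2\<close>, then a
  homomorphism \<open>g\<close> with \<open>g(x\<^sub>0) = w\<close> contradicts this; so either \<open>\<gamma>\<^sub>2(G) = \<Phi>(G)\<close>, or \<open>Z(G)\<close> is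
  elementary abelian and then equal to \<open>\<Phi>(G)\<close>.\<close>

section \<open>Extension of homomorphisms\<close>

text \<open>Finiteness supplies inverses: \<open>inv a\<close> is the power of \<open>a\<close> with
  exponent \<open>order G - 1\<close>, so closure under products suffices.\<close>

lemma (in group) finite_subgroupI:
  assumes "finite (carrier G)" "K \<subseteq> carrier G" "\<one> \<in> K"
    and mult: "\<And>x y. x \<in> K \<Longrightarrow> y \<in> K \<Longrightarrow> x \<otimes> y \<in> K"
  shows "subgroup K G"
proof (rule subgroupI)
  fix a assume a: "a \<in> K"
  then have ac: "a \<in> carrier G" using assms by auto
  have pw: "a [^] (n::nat) \<in> K" for n
    by (induction n) (use a assms in auto)
  have "order G > 0" using assms(1) by (simp add: order_gt_0_iff_finite)
  then have "a [^] (order G - 1) \<otimes> a = \<one>"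
    using pow_order_eq_1[OF ac] by (metis Suc_diff_1 nat_pow_Suc)
  then have "inv a = a [^] (order G - 1)"
    using ac by (simp add: inv_equality)
  then show "inv a \<in> K" using pw by simp
qed (use assms in auto)

text \<open>Extension of \<phi> to the subgroup generated by \<open>H\<close> and \<open>t\<close>,
  with \<open>t\<close> sent to \<open>u\<close>. Assumption \<open>conj\<close> says that
  \<open>t\<close> normalizes \<open>H\<close> and that \<open>u\<close> acts on the images in the
  same way; \<open>pow\<close> says that every relation placing a power of \<open>t\<close> in
  \<open>H\<close> is respected. The explicit form of \<open>K\<close> lets later proofs read off
  values of \<psi>.\<close>

lemma (in group) hom_extend:
  assumes fin: "finite (carrier G)" and H: "subgroup H G"
    and t: "t \<in> carrier G" and u: "u \<in> carrier G"
    and hom: "\<phi> \<in> hom (G\<lparr>carrier := H\<rparr>) G"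
    and conj: "\<And>h. h \<in> H \<Longrightarrow> \<exists>h'\<in>H. t \<otimes> h = h' \<otimes> t \<and> u \<otimes> \<phi> h = \<phi> h' \<otimes> u"
    and pow: "\<And>i::nat. t [^] i \<in> H \<Longrightarrow> \<phi> (t [^] i) = u [^] i"
  obtains K \<psi> where "subgroup K G" "H \<subseteq> K" "t \<in> K" "K = {h \<otimes> t [^] i | h (i::nat). h \<in> H}"
    "\<psi> \<in> hom (G\<lparr>carrier := K\<rparr>) G" "\<forall>h\<in>H. \<psi> h = \<phi> h" "\<psi> t = u"
    "\<forall>h\<in>H. \<forall>i::nat. \<psi> (h \<otimes> t [^] i) = \<phi> h \<otimes> u [^] i"
proof -
  note sub = subgroup.mem_carrier[OF H]
  have \<phi>c: "\<phi> h \<in> carrier G" if "h \<in> H" for h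
    using hom that by (auto simp: hom_def)
  have \<phi>m: "\<phi> (h \<otimes> k) = \<phi> h \<otimes> \<phi> k" if "h \<in> H" "k \<in> H" for h k
    using hom that by (auto simp: hom_def)
  have \<phi>1: "\<phi> \<one> = \<one>"
    using pow[of 0] H by (simp add: subgroup.one_closed)
  have wd_le: "\<phi> h \<otimes> u [^] i = \<phi> k \<otimes> u [^] j"
    if h: "h \<in> H" and k: "k \<in> H" and e: "h \<otimes> t [^] i = k \<otimes> t [^] j" and le: "i \<le> j"
    for h k and i j :: nat
  proof -
    have tj: "t [^] j = t [^] (j - i) \<otimes> t [^] i"
      using le t by (simp add: nat_pow_mult)
    have "h \<otimes> t [^] i = (k \<otimes> t [^] (j - i)) \<otimes> t [^] i"
      using e tj k t sub by (simp add: m_assoc)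
    then have hk: "h = k \<otimes> t [^] (j - i)"
      using h k t sub by (metis m_closed nat_pow_closed right_cancel)
    \<comment> \<open>Two representations of one element differ by a power of \<open>t\<close> that
      lies in \<open>H\<close>, and there \<open>pow\<close> applies.\<close>
    then have "t [^] (j - i) = inv k \<otimes> h"
      using k t sub h by (simp add: inv_solve_left)
    then have mem: "t [^] (j - i) \<in> H"
      using h k H by (simp add: subgroup.m_closed subgroup.m_inv_closed)
    have "\<phi> h = \<phi> k \<otimes> u [^] (j - i)"
      using hk \<phi>m[OF k mem] pow[OF mem] by simp
    then show ?thesis
      using le u \<phi>c[OF k] by (simp add: m_assoc nat_pow_mult)
  qed
  have wd: "\<phi> h \<otimes> u [^] i = \<phi> k \<otimes> u [^] j"
    if "h \<in> H" "k \<in> H" "h \<otimes> t [^] i = k \<otimes> t [^] j" for h k and i j :: nat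
    using wd_le[of h k i j] wd_le[of k h j i] that by (cases "i \<le> j") auto
  have conj_pow: "\<exists>h'\<in>H. t [^] i \<otimes> h = h' \<otimes> t [^] i \<and> u [^] i \<otimes> \<phi> h = \<phi> h' \<otimes> u [^] i"
    if "h \<in> H" for h and i :: nat
    using that
  proof (induction i arbitrary: h)
    case 0
    then show ?case using sub \<phi>c by auto
  next
    case (Suc i)
    obtain k where k: "k \<in> H" "t \<otimes> h = k \<otimes> t" "u \<otimes> \<phi> h = \<phi> k \<otimes> u"
      using conj[OF Suc.prems] by blast
    obtain l where l: "l \<in> H" "t [^] i \<otimes> k = l \<otimes> t [^] i" "u [^] i \<otimes> \<phi> k = \<phi> l \<otimes> u [^] i"
      using Suc.IH[OF k(1)] by blast
    have "t [^] Suc i \<otimes> h = t [^] i \<otimes> (t \<otimes> h)"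
      using Suc.prems t sub by (simp add: m_assoc)
    also have "\<dots> = l \<otimes> t [^] Suc i"
      using k l t sub by (simp add: m_assoc[symmetric])
    finally have 1: "t [^] Suc i \<otimes> h = l \<otimes> t [^] Suc i" .
    have "u [^] Suc i \<otimes> \<phi> h = u [^] i \<otimes> (u \<otimes> \<phi> h)"
      using Suc.prems u \<phi>c by (simp add: m_assoc)
    also have "\<dots> = \<phi> l \<otimes> u [^] Suc i"
      using k l u \<phi>c by (simp add: m_assoc[symmetric])
    finally show ?case using 1 l(1) by blast
  qed
  define K where "K = {h \<otimes> t [^] i | h (i::nat). h \<in> H}"
  \<comment> \<open>\<open>R\<close> is the graph of the extension; \<open>wd\<close> makes it
    single-valued, so the choice in \<psi> is forced.\<close>
  define R where "R x y \<longleftrightarrow> (\<exists>h\<in>H. \<exists>i::nat. x = h \<otimes> t [^] i \<and> y = \<phi> h \<otimes> u [^] i)" for x y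
  define \<psi> where "\<psi> x = (SOME y. R x y)" for x
  have \<psi>: "\<psi> (h \<otimes> t [^] i) = \<phi> h \<otimes> u [^] i" if "h \<in> H" for h and i :: nat
  proof -
    have ex: "R (h \<otimes> t [^] i) (\<phi> h \<otimes> u [^] i)"
      unfolding R_def using that by blast
    then have "R (h \<otimes> t [^] i) (\<psi> (h \<otimes> t [^] i))"
      unfolding \<psi>_def by (rule someI)
    then show ?thesis unfolding R_def using wd[OF that] by metis
  qed
  have prod: "\<exists>k'\<in>H. h \<otimes> t [^] i \<otimes> (k \<otimes> t [^] j) = (h \<otimes> k') \<otimes> t [^] (i + j) \<and>
      \<phi> h \<otimes> u [^] i \<otimes> (\<phi> k \<otimes> u [^] j) = \<phi> (h \<otimes> k') \<otimes> u [^] (i + j)"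
    if h: "h \<in> H" and k: "k \<in> H" for h k and i j :: nat
  proof -
    obtain k' where k': "k' \<in> H" "t [^] i \<otimes> k = k' \<otimes> t [^] i" "u [^] i \<otimes> \<phi> k = \<phi> k' \<otimes> u [^] i"
      using conj_pow[OF k] by blast
    have "h \<otimes> t [^] i \<otimes> (k \<otimes> t [^] j) = h \<otimes> (t [^] i \<otimes> k) \<otimes> t [^] j"
      using h k t sub by (simp add: m_assoc)
    also have "\<dots> = (h \<otimes> k') \<otimes> t [^] (i + j)"
      using h k k' t sub by (simp add: m_assoc nat_pow_mult)
    finally have 1: "h \<otimes> t [^] i \<otimes> (k \<otimes> t [^] j) = (h \<otimes> k') \<otimes> t [^] (i + j)" .
    have "\<phi> h \<otimes> u [^] i \<otimes> (\<phi> k \<otimes> u [^] j) = \<phi> h \<otimes> (u [^] i \<otimes> \<phi> k) \<otimes> u [^] j"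
      using h k u \<phi>c by (simp add: m_assoc)
    also have "\<dots> = \<phi> (h \<otimes> k') \<otimes> u [^] (i + j)"
      using h k k' u \<phi>c by (simp add: m_assoc nat_pow_mult \<phi>m)
    finally show ?thesis using 1 k' by blast
  qed
  have HK: "H \<subseteq> K"
  proof
    fix h assume "h \<in> H"
    then have "h = h \<otimes> t [^] (0::nat)" using sub by simp
    then show "h \<in> K" unfolding K_def using \<open>h \<in> H\<close> by blast
  qed
  have tt: "t = \<one> \<otimes> t [^] (1::nat)" using t by simp
  have tK: "t \<in> K"
    unfolding K_def using tt H subgroup.one_closed by blast
  have Kc: "K \<subseteq> carrier G" unfolding K_def using sub t by auto
  have Ksub: "subgroup K G"
  proof (rule finite_subgroupI[OF fin Kc])
    show "\<one> \<in> K" using HK H subgroup.one_closed by blast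
    fix x y assume "x \<in> K" "y \<in> K"
    then obtain h i k j where "h \<in> H" "x = h \<otimes> t [^] (i::nat)" "k \<in> H" "y = k \<otimes> t [^] (j::nat)"
      unfolding K_def by blast
    then show "x \<otimes> y \<in> K"
      unfolding K_def using prod[of h k i j] H by (auto intro: subgroup.m_closed)
  qed
  have \<psi>hom: "\<psi> \<in> hom (G\<lparr>carrier := K\<rparr>) G"
  proof (rule homI)
    fix x assume "x \<in> carrier (G\<lparr>carrier := K\<rparr>)"
    then show "\<psi> x \<in> carrier G" using \<psi> \<phi>c u by (auto simp: K_def)
  next
    fix x y assume "x \<in> carrier (G\<lparr>carrier := K\<rparr>)" "y \<in> carrier (G\<lparr>carrier := K\<rparr>)"
    then obtain h i k j where hk: "h \<in> H" "x = h \<otimes> t [^] (i::nat)" "k \<in> H" "y = k \<otimes> t [^] (j::nat)"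
      unfolding K_def by auto
    obtain k' where "k' \<in> H" "x \<otimes> y = (h \<otimes> k') \<otimes> t [^] (i + j)"
      "\<phi> h \<otimes> u [^] i \<otimes> (\<phi> k \<otimes> u [^] j) = \<phi> (h \<otimes> k') \<otimes> u [^] (i + j)"
      using prod[of h k i j] hk by blast
    then show "\<psi> (x \<otimes>\<^bsub>G\<lparr>carrier := K\<rparr>\<^esub> y) = \<psi> x \<otimes> \<psi> y"
      using hk \<psi> H by (simp add: subgroup.m_closed)
  qed
  have 1: "\<psi> h = \<phi> h" if "h \<in> H" for h
    using \<psi>[OF that, of 0] that sub \<phi>c by simp
  have 2: "\<psi> t = u"
    using \<psi>[of \<one> 1] H tt \<phi>1 u t by (simp add: subgroup.one_closed)
  show ?thesis
    by (rule that[OF Ksub HK tK K_def \<psi>hom _ 2]) (use 1 \<psi> in auto)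
qed

text \<open>Iterates \<open>hom_extend\<close> until the domain is the whole group, by induction on
  the size of the complement of \<open>H\<close>. The multiplicative relation \<open>Q\<close>
  between arguments and values is carried along, so that \<open>step\<close> may use what is known
  of the values found so far.\<close>

lemma (in group) hom_extend_carrier:
  assumes fin: "finite (carrier G)"
    and "subgroup H\<^sub>0 G" "\<phi>\<^sub>0 \<in> hom (G\<lparr>carrier := H\<^sub>0\<rparr>) G" "\<And>h. h \<in> H\<^sub>0 \<Longrightarrow> Q h (\<phi>\<^sub>0 h)"
    and mult: "\<And>x x' y y'. \<lbrakk>x \<in> carrier G; x' \<in> carrier G; y \<in> carrier G; y' \<in> carrier G; Q x y; Q x' y'\<rbrakk>
       \<Longrightarrow> Q (x \<otimes> x') (y \<otimes> y')"
    and step: "\<And>H \<phi>. \<lbrakk>subgroup H G; H\<^sub>0 \<subseteq> H; H \<noteq> carrier G; \<phi> \<in> hom (G\<lparr>carrier := H\<rparr>) G;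
        \<forall>h\<in>H\<^sub>0. \<phi> h = \<phi>\<^sub>0 h; \<forall>h\<in>H. Q h (\<phi> h)\<rbrakk> \<Longrightarrow>
        \<exists>t u. t \<in> carrier G \<and> t \<notin> H \<and> u \<in> carrier G \<and> Q t u \<and>
          (\<forall>h\<in>H. \<exists>h'\<in>H. t \<otimes> h = h' \<otimes> t \<and> u \<otimes> \<phi> h = \<phi> h' \<otimes> u) \<and>
          (\<forall>i::nat. t [^] i \<in> H \<longrightarrow> \<phi> (t [^] i) = u [^] i)"
  shows "\<exists>\<psi>. \<psi> \<in> hom G G \<and> (\<forall>h\<in>H\<^sub>0. \<psi> h = \<phi>\<^sub>0 h) \<and> (\<forall>x\<in>carrier G. Q x (\<psi> x))"
proof -
  have main: "\<exists>\<psi>. \<psi> \<in> hom G G \<and> (\<forall>h\<in>H\<^sub>0. \<psi> h = \<phi>\<^sub>0 h) \<and> (\<forall>x\<in>carrier G. Q x (\<psi> x))"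
    if "subgroup H G" "H\<^sub>0 \<subseteq> H" "\<phi> \<in> hom (G\<lparr>carrier := H\<rparr>) G"
      "\<And>h. h \<in> H\<^sub>0 \<Longrightarrow> \<phi> h = \<phi>\<^sub>0 h" "\<And>h. h \<in> H \<Longrightarrow> Q h (\<phi> h)" for H \<phi>
    using that
  proof (induction "card (carrier G - H)" arbitrary: H \<phi> rule: less_induct)
    case less
    show ?case
    proof (cases "H = carrier G")
      case True
      then show ?thesis using less.prems by (intro exI[of _ \<phi>]) (auto simp: hom_def)
    next
      case False
      obtain t u where tu: "t \<in> carrier G" "t \<notin> H" "u \<in> carrier G" "Q t u"
          "\<And>h. h \<in> H \<Longrightarrow> \<exists>h'\<in>H. t \<otimes> h = h' \<otimes> t \<and> u \<otimes> \<phi> h = \<phi> h' \<otimes> u"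
          "\<And>i::nat. t [^] i \<in> H \<Longrightarrow> \<phi> (t [^] i) = u [^] i"
        using step[OF less.prems(1,2) False less.prems(3)] less.prems(4,5) by auto
      obtain K \<psi> where K: "subgroup K G" "H \<subseteq> K" "t \<in> K" "K = {h \<otimes> t [^] i | h (i::nat). h \<in> H}"
        "\<psi> \<in> hom (G\<lparr>carrier := K\<rparr>) G" "\<forall>h\<in>H. \<psi> h = \<phi> h" "\<psi> t = u"
        "\<forall>h\<in>H. \<forall>i::nat. \<psi> (h \<otimes> t [^] i) = \<phi> h \<otimes> u [^] i"
        by (rule hom_extend[OF fin less.prems(1) tu(1,3) less.prems(3) tu(5,6)])
      \<comment> \<open>Not an assumption: the case of exponent 0 in \<open>tu(6)\<close> gives
        \<phi>(1) = 1, and \<open>Q\<close> holds on \<open>H\<close>.\<close>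
      have one: "Q \<one> \<one>"
      proof -
        have "\<phi> (t [^] (0::nat)) = u [^] (0::nat)"
          using tu(6)[of 0] less.prems(1) by (simp add: subgroup.one_closed)
        then show ?thesis
          using less.prems(5)[of \<one>] less.prems(1) by (simp add: subgroup.one_closed)
      qed
      have Qpow: "Q (t [^] i) (u [^] i)" for i :: nat
        by (induction i) (use one tu mult in auto)
      have QK: "Q x (\<psi> x)" if xK: "x \<in> K" for x
      proof -
        obtain h i where x: "h \<in> H" "x = h \<otimes> t [^] (i::nat)" using xK K(4) by blast
        have "h \<in> carrier G" "\<phi> h \<in> carrier G"
          using x less.prems(1,3) subgroup.subset by (auto simp: hom_def)
        then show ?thesis using x K(8) mult Qpow less.prems(5) tu by auto
      qed
      have "carrier G - K \<subset> carrier G - H"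
        using K(2,3) tu(1,2) by blast
      then have "card (carrier G - K) < card (carrier G - H)"
        using fin by (simp add: psubset_card_mono)
      moreover have "H\<^sub>0 \<subseteq> K" using less.prems K by auto
      moreover have "\<psi> h = \<phi>\<^sub>0 h" if "h \<in> H\<^sub>0" for h
        using that less.prems K by auto
      ultimately show ?thesis
        using less.hyps[of K \<psi>] K QK by blast
    qed
  qed
  show ?thesis
    by (rule main[OF assms(2) subset_refl assms(3)]) (use assms(4) in auto)
qed

section \<open>Groups of class two with central p-th powers\<close>

text \<open>By finiteness there is an inclusion-maximal subgroup among those containing
  \<open>H\<close> and missing \<open>x\<close>. It need not be a maximal subgroup of
  \<open>G\<close>; \<open>frattini_eq\<close> proves that it is one in the situation needed
  there.\<close>

lemma (in group) subgroup_avoiding: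
  assumes fin: "finite (carrier G)" and "subgroup H G" "x \<notin> H"
  obtains M where "subgroup M G" "H \<subseteq> M" "x \<notin> M"
    "\<forall>K. subgroup K G \<longrightarrow> M \<subseteq> K \<longrightarrow> x \<notin> K \<longrightarrow> K = M"
proof -
  let ?A = "{M. subgroup M G \<and> H \<subseteq> M \<and> x \<notin> M}"
  have "?A \<subseteq> Pow (carrier G)" using subgroup.subset by blast
  then have "finite ?A" using fin by (simp add: finite_subset)
  moreover have "?A \<noteq> {}" using assms by blast
  ultimately have "\<exists>M\<in>?A. \<forall>K\<in>?A. M \<subseteq> K \<longrightarrow> M = K"
    by (rule finite_has_maximal)
  then obtain M where M: "M \<in> ?A" "\<forall>K\<in>?A. M \<subseteq> K \<longrightarrow> M = K"
    by (rule bexE)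
  show ?thesis
  proof (rule that)
    show "\<forall>K. subgroup K G \<longrightarrow> M \<subseteq> K \<longrightarrow> x \<notin> K \<longrightarrow> K = M"
      using M by auto
  qed (use M(1) in auto)
qed

lemma (in group) subset_maximal_subgroup:
  assumes fin: "finite (carrier G)" and "subgroup H G" "H \<noteq> carrier G"
  obtains M where "maximal_subgroup M G" "H \<subseteq> M"
proof -
  let ?A = "{M. subgroup M G \<and> H \<subseteq> M \<and> M \<noteq> carrier G}"
  have "?A \<subseteq> Pow (carrier G)" using subgroup.subset by blast
  then have "finite ?A" using fin by (simp add: finite_subset)
  moreover have "?A \<noteq> {}" using assms by blast
  ultimately have "\<exists>M\<in>?A. \<forall>K\<in>?A. M \<subseteq> K \<longrightarrow> M = K"
    by (rule finite_has_maximal)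
  then obtain M where M: "M \<in> ?A" "\<forall>K\<in>?A. M \<subseteq> K \<longrightarrow> M = K"
    by (rule bexE)
  have "maximal_subgroup M G"
    unfolding maximal_subgroup_def using M by auto
  then show ?thesis using that M(1) by simp
qed

lemma (in group) center_subgroup: "subgroup (center G) G"
proof (rule subgroupI)
  fix a assume a: "a \<in> center G"
  then have ac: "a \<in> carrier G" by (simp add: center_def)
  have "inv a \<otimes> x = x \<otimes> inv a" if x: "x \<in> carrier G" for x
  proof -
    have "a \<otimes> x = x \<otimes> a" using a x by (simp add: center_def)
    then have "x = inv a \<otimes> (x \<otimes> a)" using ac x by (simp add: inv_solve_left)
    then have "x \<otimes> inv a = inv a \<otimes> (x \<otimes> a) \<otimes> inv a" by simp
    also have "\<dots> = inv a \<otimes> x" using ac x by (simp add: m_assoc)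
    finally show ?thesis by simp
  qed
  then show "inv a \<in> center G" using ac by (simp add: center_def)
next
  fix a b assume "a \<in> center G" "b \<in> center G"
  then have ab: "a \<in> carrier G" "b \<in> carrier G"
    "\<And>x. x \<in> carrier G \<Longrightarrow> a \<otimes> x = x \<otimes> a" "\<And>x. x \<in> carrier G \<Longrightarrow> b \<otimes> x = x \<otimes> b"
    by (auto simp: center_def)
  have "a \<otimes> b \<otimes> x = x \<otimes> (a \<otimes> b)" if x: "x \<in> carrier G" for x
  proof -
    have "a \<otimes> b \<otimes> x = a \<otimes> x \<otimes> b" using ab(1,2,4) x by (simp add: m_assoc)
    then show ?thesis using ab(1-3) x by (simp add: m_assoc)
  qed
  then show "a \<otimes> b \<in> center G" using ab(1,2) by (simp add: center_def)
qed (auto simp: center_def)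

section \<open>Powers in a finite p-group, p odd\<close>

locale odd_p_group = group G for G (structure) +
  fixes p :: nat
  assumes prime: "Factorial_Ring.prime p" and odd: "odd p"
    and fin: "finite (carrier G)" and order_pow: "\<exists>n. order G = p ^ n"
begin

text \<open>Since \<open>i\<close> is coprime to the group order, Bezout makes \<open>x\<close>
  itself a power of \<open>x [^] i\<close>.\<close>

lemma mem_of_pow_mem:
  assumes H: "subgroup H G" and x: "x \<in> carrier G" and i: "x [^] i \<in> H" "\<not> p dvd i"
  shows "x \<in> H"
proof -
  obtain n where n: "order G = p ^ n" using order_pow by blast
  have "coprime i (order G)"
    using i(2) prime n by (metis coprime_commute coprime_power_left_iff prime_imp_coprime)
  moreover have "i \<noteq> 0" using i(2) by (cases "i = 0") auto
  ultimately obtain j k where jk: "i * j = order G * k + 1"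
    using bezout_nat[of i "order G"] by auto
  have "(x [^] i) [^] j = (x [^] order G) [^] k \<otimes> x"
    using x jk by (simp add: nat_pow_pow)
  then have "x = (x [^] i) [^] j" using x pow_order_eq_1 by simp
  moreover have "(x [^] i) [^] k \<in> H" for k :: nat
    using i H by (induction k) (auto simp: subgroup.one_closed subgroup.m_closed)
  ultimately show ?thesis by metis
qed

lemma eq_one_of_pow_eq_one:
  assumes "x \<in> carrier G" "x [^] i = \<one>" "\<not> p dvd i"
  shows "x = \<one>"
  using mem_of_pow_mem[OF triv_subgroup, of x i] assms by simp

lemma not_dvd_2: "\<not> p dvd 2"
proof
  assume "p dvd 2"
  then have "p = 2" using prime primes_dvd_imp_eq two_is_prime_nat by blast
  then show False using odd by simp
qed

lemma pow_eq_one_of_dvd: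
  assumes "x \<in> carrier G" "x [^] p = \<one>" "p dvd i" shows "x [^] i = \<one>"
proof -
  obtain k where "i = p * k" using assms(3) by (rule dvdE)
  then have "x [^] i = (x [^] p) [^] k" using assms(1) by (simp add: nat_pow_pow)
  then show ?thesis using assms(2) by simp
qed

lemma pow_mem_subgroup:
  assumes "subgroup H G" "x \<in> H" shows "x [^] (i::nat) \<in> H"
  using assms by (induction i) (auto simp: subgroup.one_closed subgroup.m_closed)

end

locale class2_p_group = odd_p_group +
  assumes commutator_center:
      "\<lbrakk>x \<in> carrier G; y \<in> carrier G\<rbrakk> \<Longrightarrow> x \<otimes> y \<otimes> inv x \<otimes> inv y \<in> center G"
    and pow_center: "x \<in> carrier G \<Longrightarrow> x [^] p \<in> center G"
begin

section \<open>Commutator calculus in class two\<close>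

definition comm :: "'a \<Rightarrow> 'a \<Rightarrow> 'a" where
  "comm x y = x \<otimes> y \<otimes> inv x \<otimes> inv y"

lemma center_carrier [simp]: "z \<in> center G \<Longrightarrow> z \<in> carrier G"
  by (simp add: center_def)

lemma center_commute: "z \<in> center G \<Longrightarrow> x \<in> carrier G \<Longrightarrow> z \<otimes> x = x \<otimes> z"
  unfolding center_def by blast

lemma comm_in_center [simp]: "x \<in> carrier G \<Longrightarrow> y \<in> carrier G \<Longrightarrow> comm x y \<in> center G"
  using commutator_center by (simp add: comm_def)

lemma comm_swap:
  assumes "x \<in> carrier G" "y \<in> carrier G"
  shows "x \<otimes> y = comm x y \<otimes> (y \<otimes> x)"
proof -
  have "comm x y \<otimes> (y \<otimes> x) = x \<otimes> y \<otimes> inv x \<otimes> (inv y \<otimes> y) \<otimes> x"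
    by (simp only: comm_def m_assoc m_closed inv_closed assms)
  also have "\<dots> = x \<otimes> y \<otimes> (inv x \<otimes> x)"
    using assms by (simp add: m_assoc)
  finally show ?thesis using assms by simp
qed

text \<open>With this characterization, commutator identities can be proved by moving factors past
  each other, without expanding inverses.\<close>

lemma comm_unique:
  assumes "x \<in> carrier G" "y \<in> carrier G" "c \<in> carrier G" "x \<otimes> y = c \<otimes> (y \<otimes> x)"
  shows "c = comm x y"
proof -
  have "c \<otimes> (y \<otimes> x) = comm x y \<otimes> (y \<otimes> x)"
    by (rule trans[OF assms(4)[symmetric] comm_swap[OF assms(1,2)]])
  then show ?thesis using assms(1-3) by simp
qed

text \<open>Holds because \<open>comm x' y\<close> is central and passes through every
  product.\<close>

lemma comm_mult_left:
  assumes "x \<in> carrier G" "x' \<in> carrier G" "y \<in> carrier G"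
  shows "comm (x \<otimes> x') y = comm x y \<otimes> comm x' y"
proof (rule comm_unique[symmetric])
  have "x \<otimes> x' \<otimes> y = x \<otimes> (comm x' y \<otimes> (y \<otimes> x'))"
    using assms comm_swap[of x' y] by (simp add: m_assoc)
  also have "\<dots> = comm x' y \<otimes> (x \<otimes> y) \<otimes> x'"
    using assms center_commute[of "comm x' y" x] by (simp add: m_assoc[symmetric])
  also have "\<dots> = comm x' y \<otimes> (comm x y \<otimes> (y \<otimes> x)) \<otimes> x'"
    using assms comm_swap[of x y] by simp
  also have "\<dots> = comm x y \<otimes> comm x' y \<otimes> (y \<otimes> (x \<otimes> x'))"
    using assms center_commute[of "comm x' y" "comm x y"] by (simp add: m_assoc[symmetric])
  finally show "x \<otimes> x' \<otimes> y = comm x y \<otimes> comm x' y \<otimes> (y \<otimes> (x \<otimes> x'))" .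
qed (simp_all add: assms)

lemma comm_center_left:
  assumes "z \<in> center G" "y \<in> carrier G" shows "comm z y = \<one>"
  by (rule comm_unique[symmetric]) (simp_all add: assms center_commute[OF assms])

lemma comm_mult_center_right:
  assumes x: "x \<in> carrier G" and y: "y \<in> carrier G" and z: "z \<in> center G"
  shows "comm x (y \<otimes> z) = comm x y"
proof (rule comm_unique[symmetric])
  have "x \<otimes> (y \<otimes> z) = comm x y \<otimes> (y \<otimes> x) \<otimes> z"
    using x y z comm_swap[OF x y] by (simp add: m_assoc[symmetric])
  also have "\<dots> = comm x y \<otimes> (y \<otimes> z \<otimes> x)"
    using x y z center_commute[OF z x] by (simp add: m_assoc)
  finally show "x \<otimes> (y \<otimes> z) = comm x y \<otimes> (y \<otimes> z \<otimes> x)" .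
qed (simp_all add: assms)

lemma comm_pow_left:
  assumes "x \<in> carrier G" "y \<in> carrier G"
  shows "comm (x [^] (n::nat)) y = comm x y [^] n"
proof (induction n)
  case 0
  show ?case using assms comm_center_left[of \<one> y] center_subgroup
    by (simp add: subgroup.one_closed)
qed (simp add: assms comm_mult_left)

text \<open>By multiplicativity the power equals \<open>comm (x [^] p) y\<close>, and
  \<open>x [^] p\<close> is central.\<close>

lemma comm_pow_p:
  assumes "x \<in> carrier G" "y \<in> carrier G" shows "comm x y [^] p = \<one>"
  using comm_pow_left[OF assms, of p] comm_center_left[OF pow_center[OF assms(1)] assms(2)] by simp

text \<open>Collecting the factors \<open>x\<close> on the left moves one \<open>y\<close> past one
  \<open>x\<close> exactly \<open>n choose 2\<close> times, each time at the cost of a central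
  factor \<open>comm y x\<close>.\<close>

lemma mult_pow:
  assumes x: "x \<in> carrier G" and y: "y \<in> carrier G"
  shows "(x \<otimes> y) [^] (n::nat) = comm y x [^] (n choose 2) \<otimes> (x [^] n \<otimes> y [^] n)"
proof (induction n)
  case 0
  show ?case by (simp add: numeral_2_eq_2)
next
  case (Suc n)
  let ?c = "comm y x"
  have cc: "?c \<in> carrier G" using x y by simp
  have "(x \<otimes> y) [^] Suc n = ?c [^] (n choose 2) \<otimes> (x [^] n \<otimes> (y [^] n \<otimes> x) \<otimes> y)"
    using Suc x y cc by (simp add: m_assoc)
  also have "y [^] n \<otimes> x = ?c [^] n \<otimes> (x \<otimes> y [^] n)"
    using comm_swap[of "y [^] n" x] comm_pow_left[of y x n] x y by simp
  also have "x [^] n \<otimes> (?c [^] n \<otimes> (x \<otimes> y [^] n)) \<otimes> y = ?c [^] n \<otimes> (x [^] Suc n \<otimes> y [^] Suc n)"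
  proof -
    have "?c [^] n \<in> center G"
      using x y center_subgroup by (simp add: pow_mem_subgroup)
    then have "x [^] n \<otimes> ?c [^] n = ?c [^] n \<otimes> x [^] n"
      using x center_commute[of "?c [^] n" "x [^] n"] by simp
    then show ?thesis using x y cc by (simp add: m_assoc[symmetric])
  qed
  finally show ?case
    using x y cc by (simp add: m_assoc[symmetric] nat_pow_mult numeral_2_eq_2 add.commute)
qed

text \<open>For odd \<open>p\<close> the binomial coefficient \<open>p choose 2\<close> is a
  multiple of \<open>p\<close>, which kills the commutator factor. Thus the p-th power map is an
  endomorphism.\<close>

lemma mult_pow_p:
  assumes x: "x \<in> carrier G" and y: "y \<in> carrier G"
  shows "(x \<otimes> y) [^] p = x [^] p \<otimes> y [^] p"
proof -
  have "p dvd p choose 2"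
  proof -
    obtain m where "p = 2 * m + 1" using odd by (rule oddE)
    then have "p choose 2 = p * m" by (simp add: choose_two)
    then show ?thesis by simp
  qed
  then have "comm y x [^] (p choose 2) = \<one>"
    using pow_eq_one_of_dvd comm_pow_p x y by simp
  then show ?thesis using mult_pow[OF x y] x y by simp
qed

text \<open>The subgroup usually written Omega_1(Z(G)).\<close>

definition Omega :: "'a set" where
  "Omega = {z \<in> center G. z [^] p = \<one>}"

lemma Omega_subgroup: "subgroup Omega G"
proof (rule finite_subgroupI[OF fin])
  show "\<one> \<in> Omega"
    using center_subgroup by (simp add: Omega_def subgroup.one_closed)
  show "x \<otimes> y \<in> Omega" if "x \<in> Omega" "y \<in> Omega" for x y
    using that center_subgroup by (simp add: Omega_def mult_pow_p subgroup.m_closed)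
qed (auto simp: Omega_def)

lemma derived_subgroup: "subgroup (derived G (carrier G)) G"
  using derived_is_subgroup by simp

lemma derived_subset_iff:
  assumes "subgroup H G"
  shows "derived G (carrier G) \<subseteq> H \<longleftrightarrow> (\<forall>x\<in>carrier G. \<forall>y\<in>carrier G. comm x y \<in> H)"
proof
  assume "derived G (carrier G) \<subseteq> H"
  then show "\<forall>x\<in>carrier G. \<forall>y\<in>carrier G. comm x y \<in> H"
    unfolding derived_def comm_def by (blast intro: generate.incl)
next
  assume "\<forall>x\<in>carrier G. \<forall>y\<in>carrier G. comm x y \<in> H"
  then have "derived_set G (carrier G) \<subseteq> H" by (auto simp: comm_def)
  then show "derived G (carrier G) \<subseteq> H"
    unfolding derived_def by (rule generate_subgroup_incl[OF _ assms])
qed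

lemma comm_in_derived: "x \<in> carrier G \<Longrightarrow> y \<in> carrier G \<Longrightarrow> comm x y \<in> derived G (carrier G)"
  using derived_subset_iff[OF derived_subgroup] by blast

lemma derived_subset_Omega: "derived G (carrier G) \<subseteq> Omega"
  using derived_subset_iff[OF Omega_subgroup] comm_pow_p by (simp add: Omega_def)

lemma derived_subset_center: "derived G (carrier G) \<subseteq> center G"
  using derived_subset_Omega by (auto simp: Omega_def)

text \<open>A subgroup containing the derived subgroup is normal; the explicit witness has the shape
  that \<open>hom_extend\<close> asks for.\<close>

lemma normalizes:
  assumes H: "subgroup H G" "derived G (carrier G) \<subseteq> H" and "t \<in> carrier G" "h \<in> H"
  shows "comm t h \<otimes> h \<in> H" "t \<otimes> h = (comm t h \<otimes> h) \<otimes> t"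
proof -
  have h: "h \<in> carrier G" using assms(4) by (rule subgroup.mem_carrier[OF H(1)])
  show "comm t h \<otimes> h \<in> H"
    using subgroup.m_closed[OF H(1) _ assms(4)] H(2) comm_in_derived[OF assms(3) h] by blast
  show "t \<otimes> h = (comm t h \<otimes> h) \<otimes> t"
    using comm_swap[OF assms(3) h] h assms(3) by (simp add: m_assoc)
qed

text \<open>Either alternative in \<open>n\<close> makes \<open>t\<close> normalize
  \<open>H\<close>. Extending the trivial homomorphism by \<open>hom_extend\<close> with
  \<open>u\<close> equal to 1 then delivers the subgroup as a by-product.\<close>

lemma adjoin_subgroup:
  assumes H: "subgroup H G" and t: "t \<in> carrier G"
    and n: "derived G (carrier G) \<subseteq> H \<or> t \<in> center G"
  shows "subgroup {h \<otimes> t [^] i | h (i::nat). h \<in> H} G" "H \<subseteq> {h \<otimes> t [^] i | h (i::nat). h \<in> H}"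
    "t \<in> {h \<otimes> t [^] i | h (i::nat). h \<in> H}"
proof -
  have 1: "(\<lambda>_. \<one>) \<in> hom (G\<lparr>carrier := H\<rparr>) G" by (simp add: hom_def)
  have 2: "\<exists>h'\<in>H. t \<otimes> h = h' \<otimes> t \<and> \<one> \<otimes> \<one> = \<one> \<otimes> \<one>" if h: "h \<in> H" for h
    using n
  proof
    assume "derived G (carrier G) \<subseteq> H"
    then show ?thesis using normalizes[OF H _ t h] by blast
  next
    assume "t \<in> center G"
    then have "t \<otimes> h = h \<otimes> t"
      using h subgroup.mem_carrier[OF H] by (intro center_commute)
    then show ?thesis using h by blast
  qed
  have 3: "\<one> = \<one> [^] i" if "t [^] i \<in> H" for i :: nat
    by simp
  note ext = hom_extend[OF fin H t one_closed 1 2 3]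
  show "subgroup {h \<otimes> t [^] i | h (i::nat). h \<in> H} G"
    by (rule ext, assumption, assumption) (hypsubst, assumption)
  show "H \<subseteq> {h \<otimes> t [^] i | h (i::nat). h \<in> H}"
    by (rule ext, assumption, assumption) (hypsubst, assumption)
  show "t \<in> {h \<otimes> t [^] i | h (i::nat). h \<in> H}"
    by (rule ext, assumption, assumption) (hypsubst, assumption)
qed

section \<open>Maximal subgroups and the Frattini subgroup\<close>

lemma maximal_subgroup_adjoin:
  assumes M: "maximal_subgroup M G" and t: "t \<in> carrier G" "t \<notin> M"
    and n: "derived G (carrier G) \<subseteq> M \<or> t \<in> center G" and x: "x \<in> carrier G"
  obtains m i where "m \<in> M" "x = m \<otimes> t [^] (i::nat)"
proof -
  have "subgroup M G" using M by (simp add: maximal_subgroup_def)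
  note adj = adjoin_subgroup[OF this t(1) n]
  define K where "K = {h \<otimes> t [^] i | h (i::nat). h \<in> M}"
  have "K = M \<or> K = carrier G"
    using M adj(1,2) unfolding maximal_subgroup_def K_def[symmetric] by blast
  then have "K = carrier G" using adj(3) t(2) unfolding K_def[symmetric] by blast
  then have "x \<in> K" using x by simp
  then show ?thesis using that unfolding K_def by blast
qed

text \<open>If a commutator c = [x,y] were outside \<open>M\<close>, then, c being central,
  \<open>M\<close> and c would generate the group. So x and y differ from elements m and k of
  \<open>M\<close> only by powers of c, and c = [m,k] lies in \<open>M\<close> after all.\<close>

lemma derived_subset_maximal:
  assumes M: "maximal_subgroup M G"
  shows "derived G (carrier G) \<subseteq> M"
proof -
  have Ms: "subgroup M G" using M by (simp add: maximal_subgroup_def)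
  have "comm x y \<in> M" if x: "x \<in> carrier G" and y: "y \<in> carrier G" for x y
  proof (rule ccontr)
    let ?c = "comm x y"
    assume c: "?c \<notin> M"
    have cZ: "?c \<in> center G" using x y by simp
    have cp: "?c [^] (i::nat) \<in> center G" for i
      using cZ center_subgroup by (simp add: pow_mem_subgroup)
    obtain m i where m: "m \<in> M" "x = m \<otimes> ?c [^] (i::nat)"
      by (rule maximal_subgroup_adjoin[OF M center_carrier[OF cZ] c disjI2[OF cZ] x])
    obtain k j where k: "k \<in> M" "y = k \<otimes> ?c [^] (j::nat)"
      by (rule maximal_subgroup_adjoin[OF M center_carrier[OF cZ] c disjI2[OF cZ] y])
    let ?a = "?c [^] i" and ?b = "?c [^] j"
    have mk: "m \<in> carrier G" "k \<in> carrier G"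
      using m(1) k(1) by (auto intro: subgroup.mem_carrier[OF Ms])
    have ab: "?a \<in> carrier G" "?b \<in> carrier G" using cp by auto
    have "?c = comm m y"
      using comm_mult_left[OF mk(1) ab(1) y] comm_center_left[OF cp y] m(2) mk y by simp
    also have "\<dots> = comm m k"
      using comm_mult_center_right[OF mk cp[of j]] k(2) by simp
    finally have "comm m k = ?c" ..
    moreover have "comm m k \<in> M"
      using m(1) k(1) by (simp add: comm_def subgroup.m_closed[OF Ms] subgroup.m_inv_closed[OF Ms])
    ultimately show False using c by simp
  qed
  then show ?thesis using derived_subset_iff[OF Ms] by blast
qed

text \<open>Otherwise \<open>M\<close> and \<open>x [^] p\<close> generate the group, so x = m
  x^(pi) with m in \<open>M\<close>. Then x^(1-pi) lies in \<open>M\<close>, its exponent is prime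
  to p, and x itself lies in \<open>M\<close>.\<close>

lemma pow_in_maximal:
  assumes M: "maximal_subgroup M G" and x: "x \<in> carrier G"
  shows "x [^] p \<in> M"
proof (rule ccontr)
  assume n: "x [^] p \<notin> M"
  have Ms: "subgroup M G" using M by (simp add: maximal_subgroup_def)
  obtain m i where m: "m \<in> M" "x = m \<otimes> (x [^] p) [^] (i::nat)"
    by (rule maximal_subgroup_adjoin[OF M nat_pow_closed[OF x] n disjI1[OF derived_subset_maximal[OF M]] x])
  have mc: "m \<in> carrier G" using m(1) by (rule subgroup.mem_carrier[OF Ms])
  have "m = x \<otimes> inv (x [^] (p * i))"
  proof (rule inv_solve_right[THEN iffD2])
    show "x = m \<otimes> x [^] (p * i)" using m(2) x by (simp only: nat_pow_pow)
  qed (use mc x in auto)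
  then have mx: "x \<otimes> inv (x [^] (p * i)) \<in> M" using m by simp
  have "x [^] (p * i) \<in> M"
  proof -
    \<comment> \<open>Exponents are natural numbers, so the inverse is rewritten as a positive power
      whose exponent is still a multiple of \<open>p\<close>.\<close>
    have "inv (x [^] (p * i)) = x [^] (p * i * (order G - 1))"
    proof (rule inv_equality)
      have "order G > 0" using fin by (simp add: order_gt_0_iff_finite)
      then have "p * i * (order G - 1) + p * i = order G * (p * i)"
        by (simp add: algebra_simps diff_mult_distrib2)
      then have "x [^] (p * i * (order G - 1)) \<otimes> x [^] (p * i) = (x [^] order G) [^] (p * i)"
        using x by (simp add: nat_pow_mult nat_pow_pow)
      then show "x [^] (p * i * (order G - 1)) \<otimes> x [^] (p * i) = \<one>"
        using x pow_order_eq_1 by simp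
    qed (use x in auto)
    then have "x [^] (1 + p * i * (order G - 1)) \<in> M"
      using mx x nat_pow_mult[OF x, of 1 "p * i * (order G - 1)"] by simp
    moreover have "\<not> p dvd 1 + p * i * (order G - 1)"
    proof
      assume "p dvd 1 + p * i * (order G - 1)"
      then have "p dvd 1"
        by (rule dvd_add_left_iff[THEN iffD1, rotated]) (simp add: mult.assoc)
      then show False using prime not_prime_unit by blast
    qed
    ultimately have "x \<in> M" using mem_of_pow_mem[OF Ms x] by blast
    then show ?thesis by (rule pow_mem_subgroup[OF Ms])
  qed
  then have "m \<otimes> (x [^] p) [^] i \<in> M"
    using subgroup.m_closed[OF Ms m(1)] x by (simp add: nat_pow_pow)
  then have "x [^] p \<in> M"
    using m(2) pow_mem_subgroup[OF Ms, of x p] by simp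
  then show False using n by simp
qed

text \<open>Every maximal subgroup contains all p-th powers and commutators, hence \<open>P\<close>.
  Conversely, for x outside \<open>P\<close>, a subgroup M containing \<open>P\<close> and maximal
  with respect to missing x is shown to be a maximal subgroup.\<close>

lemma frattini_eq:
  "frattini G = {x [^] p \<otimes> c | x c. x \<in> carrier G \<and> c \<in> derived G (carrier G)}"
proof -
  define P where "P = {x [^] p \<otimes> c | x c. x \<in> carrier G \<and> c \<in> derived G (carrier G)}"
  note D = subgroup.mem_carrier[OF derived_subgroup]
  have PI: "x [^] p \<otimes> c \<in> P" if "x \<in> carrier G" "c \<in> derived G (carrier G)" for x c
    unfolding P_def using that by blast
  have Pc: "P \<subseteq> carrier G" unfolding P_def using D by auto
  have DP: "derived G (carrier G) \<subseteq> P"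
  proof
    fix c assume c: "c \<in> derived G (carrier G)"
    then show "c \<in> P" using PI[OF one_closed c] D[OF c] by simp
  qed
  have Pp: "x [^] p \<in> P" if "x \<in> carrier G" for x
    using PI[OF that subgroup.one_closed[OF derived_subgroup]] that by simp
  have Ps: "subgroup P G"
  proof (rule finite_subgroupI[OF fin Pc])
    show "\<one> \<in> P" using DP subgroup.one_closed[OF derived_subgroup] by blast
    fix a b assume "a \<in> P" "b \<in> P"
    then obtain x c y d where xc: "a = x [^] p \<otimes> c" "x \<in> carrier G" "c \<in> derived G (carrier G)"
      "b = y [^] p \<otimes> d" "y \<in> carrier G" "d \<in> derived G (carrier G)"
      unfolding P_def by blast
    note cd = D[OF xc(3)] D[OF xc(6)]
    have "a \<otimes> b = x [^] p \<otimes> (c \<otimes> y [^] p) \<otimes> d"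
      unfolding xc(1,4) using xc(2,5) cd by (simp add: m_assoc)
    also have "c \<otimes> y [^] p = y [^] p \<otimes> c"
      using xc(3,5) derived_subset_center by (intro center_commute) auto
    finally have "a \<otimes> b = (x \<otimes> y) [^] p \<otimes> (c \<otimes> d)"
      using xc(2,5) cd by (simp add: m_assoc mult_pow_p)
    then show "a \<otimes> b \<in> P"
      using PI[OF m_closed[OF xc(2,5)] subgroup.m_closed[OF derived_subgroup xc(3,6)]] by simp
  qed
  have "P \<subseteq> frattini G"
  proof
    fix y assume y: "y \<in> P"
    then obtain x c where xc: "y = x [^] p \<otimes> c" "x \<in> carrier G" "c \<in> derived G (carrier G)"
      unfolding P_def by blast
    have "y \<in> M" if M: "maximal_subgroup M G" for M
    proof -
      have Ms: "subgroup M G" using M by (simp add: maximal_subgroup_def)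
      have "c \<in> M" using derived_subset_maximal[OF M] xc(3) by blast
      then show ?thesis
        unfolding xc(1) by (rule subgroup.m_closed[OF Ms pow_in_maximal[OF M xc(2)]])
    qed
    then show "y \<in> frattini G" using y Pc unfolding frattini_def by blast
  qed
  moreover have "frattini G \<subseteq> P"
  proof
    fix x assume x: "x \<in> frattini G"
    then have xc: "x \<in> carrier G" by (simp add: frattini_def)
    show "x \<in> P"
    proof (rule ccontr)
      assume "x \<notin> P"
      then obtain M where M: "subgroup M G" "P \<subseteq> M" "x \<notin> M"
          "\<forall>K. subgroup K G \<longrightarrow> M \<subseteq> K \<longrightarrow> x \<notin> K \<longrightarrow> K = M"
        by (rule subgroup_avoiding[OF fin Ps])
      have DM: "derived G (carrier G) \<subseteq> M" using DP M(2) by blast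
      have xin: "x \<in> K" if "subgroup K G" "M \<subseteq> K" "K \<noteq> M" for K
        using M(4) that by blast
      \<comment> \<open>For y outside \<open>M\<close>, adjoining y captures x, so x = m y^i; as y^p
        lies in \<open>M\<close> and x does not, i is prime to p. Hence \<open>M\<close> and x
        together yield y, and no proper subgroup contains both.\<close>
      have gen: "y \<in> K" if K: "subgroup K G" "M \<subseteq> K" "x \<in> K" and y: "y \<in> carrier G" for K y
      proof (cases "y \<in> M")
        case False
        note adj = adjoin_subgroup[OF M(1) y disjI1[OF DM]]
        have "x \<in> {h \<otimes> y [^] i | h (i::nat). h \<in> M}"
        proof (rule xin[OF adj(1,2)])
          show "{h \<otimes> y [^] i | h (i::nat). h \<in> M} \<noteq> M"
            using adj(3) False by (metis (no_types))
        qed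
        then obtain m i where m: "m \<in> M" "x = m \<otimes> y [^] (i::nat)" by blast
        have mc: "m \<in> carrier G" using m(1) by (rule subgroup.mem_carrier[OF M(1)])
        have "\<not> p dvd i"
        proof
          assume "p dvd i"
          then obtain j where "i = p * j" by blast
          then have "y [^] i = (y [^] p) [^] j" using y by (simp add: nat_pow_pow)
          moreover have "y [^] p \<in> M" using Pp[OF y] M(2) by blast
          ultimately have "y [^] i \<in> M" using pow_mem_subgroup[OF M(1), of "y [^] p" j] by simp
          then show False using m M(3) subgroup.m_closed[OF M(1) m(1)] by simp
        qed
        moreover have "y [^] i = inv m \<otimes> x"
          using m(2) mc y xc by (intro inv_solve_left[THEN iffD2]) auto
        then have "y [^] i \<in> K"
          using subgroup.m_closed[OF K(1) subgroup.m_inv_closed[OF K(1)] K(3), of m] m(1) K(2) by auto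
        ultimately show ?thesis using mem_of_pow_mem[OF K(1) y] by blast
      qed (use K in blast)
      have "maximal_subgroup M G"
        unfolding maximal_subgroup_def
      proof (intro conjI allI impI)
        show "M \<noteq> carrier G" using M xc by blast
        fix H assume H: "subgroup H G" "M \<subseteq> H"
        show "H = M \<or> H = carrier G"
          using xin[OF H] gen[OF H] subgroup.subset[OF H(1)] by blast
      qed (rule M(1))
      then show False using x M(3) unfolding frattini_def by blast
    qed
  qed
  ultimately show ?thesis unfolding P_def by (rule subset_antisym[rotated])
qed

text \<open>Well defined because a power of \<open>t\<close> lies in \<open>M\<close> only if
  \<open>p\<close> divides the exponent, and then the same power of \<open>c\<close> is 1.
  Injectivity is not claimed: it can fail when \<open>c\<close> is outside \<open>M\<close>.\<close>

lemma transvection: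
  assumes M: "maximal_subgroup M G" and t: "t \<in> carrier G" "t \<notin> M" and c: "c \<in> Omega"
  obtains \<psi> where "\<psi> \<in> hom G G" "\<And>m. m \<in> M \<Longrightarrow> \<psi> m = m" "\<psi> t = t \<otimes> c"
    "\<And>x. x \<in> carrier G \<Longrightarrow> \<exists>i::nat. \<psi> x = x \<otimes> c [^] i"
proof -
  have Ms: "subgroup M G" using M by (simp add: maximal_subgroup_def)
  note D = derived_subset_maximal[OF M]
  note Mc = subgroup.mem_carrier[OF Ms]
  have cZ: "c \<in> center G" "c [^] p = \<one>" "c \<in> carrier G"
    using c unfolding Omega_def by simp_all
  have cp: "c [^] (i::nat) \<in> center G" for i
    using cZ center_subgroup by (simp add: pow_mem_subgroup)
  have tc: "(t \<otimes> c) [^] i = t [^] i \<otimes> c [^] i" for i :: nat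
    by (rule pow_mult_distrib[OF center_commute[OF cZ(1) t(1), symmetric] t(1) cZ(3)])
  have id: "(\<lambda>x. x) \<in> hom (G\<lparr>carrier := M\<rparr>) G" using Mc by (auto simp: hom_def)
  have conj: "\<exists>h'\<in>M. t \<otimes> h = h' \<otimes> t \<and> t \<otimes> c \<otimes> h = h' \<otimes> (t \<otimes> c)" if h: "h \<in> M" for h
  proof -
    let ?h = "comm t h \<otimes> h"
    have h': "?h \<in> M" "t \<otimes> h = ?h \<otimes> t" using normalizes[OF Ms D t(1) h] .
    have "t \<otimes> c \<otimes> h = t \<otimes> h \<otimes> c"
      using center_commute[OF cZ(1) Mc[OF h]] t(1) cZ(3) Mc[OF h] by (simp add: m_assoc)
    also have "\<dots> = ?h \<otimes> (t \<otimes> c)"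
      unfolding h'(2) using Mc[OF h'(1)] t(1) cZ(3) by (simp add: m_assoc)
    finally show ?thesis using h' by blast
  qed
  have pow: "t [^] i = (t \<otimes> c) [^] i" if "t [^] i \<in> M" for i :: nat
  proof -
    have "p dvd i" using mem_of_pow_mem[OF Ms t(1) that] t(2) by blast
    then have "c [^] i = \<one>" by (rule pow_eq_one_of_dvd[OF cZ(3,2)])
    then show ?thesis using tc[of i] t(1) by simp
  qed
  obtain K \<psi> where K: "subgroup K G" "M \<subseteq> K" "t \<in> K" "K = {h \<otimes> t [^] i | h (i::nat). h \<in> M}"
    "\<psi> \<in> hom (G\<lparr>carrier := K\<rparr>) G" "\<forall>h\<in>M. \<psi> h = h" "\<psi> t = t \<otimes> c"
    "\<forall>h\<in>M. \<forall>i::nat. \<psi> (h \<otimes> t [^] i) = h \<otimes> (t \<otimes> c) [^] i"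
    by (rule hom_extend[OF fin Ms t(1) m_closed[OF t(1) cZ(3)] id conj pow])
  have KG: "K = carrier G"
    using M K(1-3) t(2) unfolding maximal_subgroup_def by blast
  show ?thesis
  proof (rule that)
    have "hom (G\<lparr>carrier := carrier G\<rparr>) G = hom G G" by (simp add: hom_def)
    then show "\<psi> \<in> hom G G" using K(5) unfolding KG by simp
    show "\<exists>i::nat. \<psi> x = x \<otimes> c [^] i" if "x \<in> carrier G" for x
    proof -
      have "x \<in> {h \<otimes> t [^] i | h (i::nat). h \<in> M}"
        using that unfolding KG[symmetric] K(4) .
      then obtain h i where x: "h \<in> M" "x = h \<otimes> t [^] (i::nat)" by blast
      then have "\<psi> x = x \<otimes> c [^] i"
        using K(8) tc t cZ Mc by (simp add: m_assoc)
      then show ?thesis by blast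
    qed
  qed (use K(6,7) in simp_all)
qed

end

section \<open>Automorphisms\<close>

lemma (in group) inj_onI_hom:
  assumes "\<sigma> \<in> hom G G" and "\<And>x. x \<in> carrier G \<Longrightarrow> \<sigma> x = \<one> \<Longrightarrow> x = \<one>"
  shows "inj_on \<sigma> (carrier G)"
  using inj_on_one_iff'[OF assms(1) is_group is_group] assms(2) by blast

lemma (in group) endo_closed: "\<sigma> \<in> hom G G \<Longrightarrow> x \<in> carrier G \<Longrightarrow> \<sigma> x \<in> carrier G"
  by (rule hom_in_carrier)

lemma (in group) endo_mult:
  "\<sigma> \<in> hom G G \<Longrightarrow> x \<in> carrier G \<Longrightarrow> y \<in> carrier G \<Longrightarrow> \<sigma> (x \<otimes> y) = \<sigma> x \<otimes> \<sigma> y"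
  by (rule hom_mult)

lemma (in group) endo_pow:
  "\<sigma> \<in> hom G G \<Longrightarrow> x \<in> carrier G \<Longrightarrow> \<sigma> (x [^] (n::nat)) = \<sigma> x [^] n"
  by (rule hom_nat_pow[OF _ _ is_group is_group])

text \<open>Members of \<open>auto G\<close> are extensional, hence the restriction; surjectivity
  comes from finiteness.\<close>

lemma (in group) restrict_in_auto:
  assumes fin: "finite (carrier G)" and "\<sigma> \<in> hom G G" "inj_on \<sigma> (carrier G)"
  shows "restrict \<sigma> (carrier G) \<in> auto G"
proof -
  have "\<sigma> ` carrier G \<subseteq> carrier G" using assms(2) by (auto simp: hom_def)
  then have "\<sigma> ` carrier G = carrier G"
    using endo_inj_surj[OF fin] assms(3) by blast
  then have "bij_betw (restrict \<sigma> (carrier G)) (carrier G) (carrier G)"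
    using assms(3) by (simp add: bij_betw_def inj_on_restrict_eq)
  moreover have "restrict \<sigma> (carrier G) \<in> hom G G"
    using assms(2) by (auto simp: hom_def)
  ultimately show ?thesis by (simp add: auto_def Bij_def)
qed

lemma AutoGroup_mult:
  assumes "\<sigma> \<in> auto G" "\<tau> \<in> auto G" "x \<in> carrier G"
  shows "(\<sigma> \<otimes>\<^bsub>AutoGroup G\<^esub> \<tau>) x = \<sigma> (\<tau> x)"
  using assms by (simp add: AutoGroup_def BijGroup_def auto_def compose_def)

lemma (in group) AutoGroup_pow:
  assumes \<sigma>: "\<sigma> \<in> auto G" and x: "x \<in> carrier G"
  shows "(\<sigma> [^]\<^bsub>AutoGroup G\<^esub> n) x = (\<sigma> ^^ n) x"
proof -
  interpret A: group "AutoGroup G" by (rule AutoGroup)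
  have c: "carrier (AutoGroup G) = auto G" by (simp add: AutoGroup_def)
  show ?thesis
    using x
  proof (induction n arbitrary: x)
    case 0
    then show ?case by (simp add: AutoGroup_def BijGroup_def)
  next
    case (Suc n)
    have "\<sigma> x \<in> carrier G" using \<sigma> Suc.prems by (auto simp: auto_def hom_def)
    then show ?case
      using Suc AutoGroup_mult[of "\<sigma> [^]\<^bsub>AutoGroup G\<^esub> n" G \<sigma> x] \<sigma> A.nat_pow_closed[of \<sigma> n] c
      by (simp add: funpow_swap1)
  qed
qed

text \<open>This and \<open>AutoGroup_exponent\<close> turn facts about the group of automorphisms
  into pointwise facts about injective endomorphisms, free of restrictions.\<close>

lemma (in group) AutoGroup_commute:
  assumes fin: "finite (carrier G)" and ab: "comm_group (AutoGroup G)"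
    and \<sigma>: "\<sigma> \<in> hom G G" "inj_on \<sigma> (carrier G)" and \<tau>: "\<tau> \<in> hom G G" "inj_on \<tau> (carrier G)"
    and x: "x \<in> carrier G"
  shows "\<sigma> (\<tau> x) = \<tau> (\<sigma> x)"
proof -
  interpret A: comm_group "AutoGroup G" by (rule ab)
  let ?s = "restrict \<sigma> (carrier G)" and ?t = "restrict \<tau> (carrier G)"
  have st: "?s \<in> auto G" "?t \<in> auto G" using restrict_in_auto[OF fin] \<sigma> \<tau> by auto
  then have "?s \<otimes>\<^bsub>AutoGroup G\<^esub> ?t = ?t \<otimes>\<^bsub>AutoGroup G\<^esub> ?s"
    by (intro A.m_comm) (simp_all add: AutoGroup_def)
  then have "?s (?t x) = ?t (?s x)"
    using AutoGroup_mult[OF st x] AutoGroup_mult[OF st(2,1) x] by simp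
  then show ?thesis
    using x endo_closed[OF \<sigma>(1) x] endo_closed[OF \<tau>(1) x] by simp
qed

lemma (in group) AutoGroup_exponent:
  assumes fin: "finite (carrier G)" and q: "\<forall>f\<in>carrier (AutoGroup G). f [^]\<^bsub>AutoGroup G\<^esub> (q::nat) = \<one>\<^bsub>AutoGroup G\<^esub>"
    and \<sigma>: "\<sigma> \<in> hom G G" "inj_on \<sigma> (carrier G)" and x: "x \<in> carrier G"
  shows "(\<sigma> ^^ q) x = x"
proof -
  let ?s = "restrict \<sigma> (carrier G)"
  have s: "?s \<in> auto G" using restrict_in_auto[OF fin \<sigma>] .
  have "(?s ^^ n) x = (\<sigma> ^^ n) x \<and> (\<sigma> ^^ n) x \<in> carrier G" for n
    by (induction n) (use x endo_closed[OF \<sigma>(1)] in auto)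
  moreover have "(?s [^]\<^bsub>AutoGroup G\<^esub> q) x = x"
    using q s x by (simp add: AutoGroup_def BijGroup_def)
  ultimately show ?thesis using AutoGroup_pow[OF s x, of q] by simp
qed

lemma involution_eq_id:
  fixes \<sigma> :: "'a \<Rightarrow> 'a"
  assumes "(\<sigma> ^^ n) x = x" "\<sigma> (\<sigma> x) = x" "odd n"
  shows "\<sigma> x = x"
proof -
  obtain m where m: "n = 2 * m + 1" using assms(3) by (rule oddE)
  have "(\<sigma> ^^ (2 * k)) x = x" for k
  proof (induction k)
    case (Suc k)
    have "(\<sigma> ^^ (2 * Suc k)) x = (\<sigma> ^^ (2 * k)) (\<sigma> (\<sigma> x))"
      by (simp add: funpow_swap1)
    then show ?case using Suc assms(2) by simp
  qed simp
  then show ?thesis using assms(1) m by simp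
qed

context class2_p_group
begin

lemma Omega_carrier [simp]: "c \<in> Omega \<Longrightarrow> c \<in> carrier G"
  by (simp add: Omega_def)

text \<open>A kernel element is the inverse of a power of \<open>c\<close>, so it lies in
  \<open>M\<close>, where \<psi> is the identity.\<close>

lemma transvection_inj:
  assumes M: "maximal_subgroup M G" and c: "c \<in> Omega" "c \<in> M"
    and \<psi>: "\<psi> \<in> hom G G" "\<And>m. m \<in> M \<Longrightarrow> \<psi> m = m"
    "\<And>x. x \<in> carrier G \<Longrightarrow> \<exists>i::nat. \<psi> x = x \<otimes> c [^] i"
  shows "inj_on \<psi> (carrier G)"
proof (rule inj_onI_hom[OF \<psi>(1)])
  fix x assume x: "x \<in> carrier G" "\<psi> x = \<one>"
  have Ms: "subgroup M G" using M by (simp add: maximal_subgroup_def)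
  obtain i :: nat where i: "\<psi> x = x \<otimes> c [^] i" using \<psi>(3)[OF x(1)] by blast
  have ci: "c [^] i \<in> M" using c(2) by (rule pow_mem_subgroup[OF Ms])
  have "x = inv (c [^] i)"
    using i x c by (simp add: inv_equality[symmetric])
  then have "x \<in> M" using subgroup.m_inv_closed[OF Ms ci] by simp
  then show "x = \<one>" using \<psi>(2) x(2) by simp
qed

lemma elementary_abelian_subgroup:
  assumes H: "subgroup H G" "H \<subseteq> Omega"
  shows "elementary_abelian (G\<lparr>carrier := H\<rparr>)"
proof -
  have "comm_group (G\<lparr>carrier := H\<rparr>)"
  proof (rule group.group_comm_groupI)
    show "group (G\<lparr>carrier := H\<rparr>)" using H(1) by (rule subgroup.subgroup_is_group) (rule is_group)
    fix x y assume "x \<in> carrier (G\<lparr>carrier := H\<rparr>)" "y \<in> carrier (G\<lparr>carrier := H\<rparr>)"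
    then have "x \<in> center G" "y \<in> carrier G" using H(2) by (auto simp: Omega_def)
    then show "x \<otimes>\<^bsub>G\<lparr>carrier := H\<rparr>\<^esub> y = y \<otimes>\<^bsub>G\<lparr>carrier := H\<rparr>\<^esub> x"
      using center_commute by simp
  qed
  moreover have "x [^]\<^bsub>G\<lparr>carrier := H\<rparr>\<^esub> p = \<one>\<^bsub>G\<lparr>carrier := H\<rparr>\<^esub>" if "x \<in> H" for x
    using that H(2) by (auto simp: Omega_def nat_pow_consistent[symmetric])
  ultimately show ?thesis
    unfolding elementary_abelian_def using prime by auto
qed

lemma comm_inverse:
  assumes "x \<in> carrier G" "y \<in> carrier G" shows "comm x y \<otimes> comm y x = \<one>"
proof -
  have "comm x y \<otimes> comm y x \<otimes> (x \<otimes> y) = comm x y \<otimes> (comm y x \<otimes> (x \<otimes> y))"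
    using assms by (simp add: m_assoc)
  also have "\<dots> = x \<otimes> y" by (simp only: comm_swap[OF assms(2,1), symmetric] comm_swap[OF assms, symmetric])
  finally have "comm x y \<otimes> comm y x \<otimes> (x \<otimes> y) = \<one> \<otimes> (x \<otimes> y)" using assms by simp
  then show ?thesis using assms by (metis center_carrier comm_in_center m_closed one_closed right_cancel)
qed

end

text \<open>The binomial theorem modulo p^3, for arbitrary natural p; used below with n = p.\<close>

lemma one_plus_power_expansion: "\<exists>k. (1 + p) ^ n = 1 + n * p + (n choose 2) * p\<^sup>2 + p ^ 3 * (k::nat)"
proof (induction n)
  case (Suc n)
  then obtain k where k: "(1 + p) ^ n = 1 + n * p + (n choose 2) * p\<^sup>2 + p ^ 3 * k" by blast
  have "Suc n choose 2 = n + (n choose 2)" by (simp add: numeral_2_eq_2)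
  then have "(1 + p) ^ Suc n = 1 + Suc n * p + (Suc n choose 2) * p\<^sup>2 + p ^ 3 * ((n choose 2) + k + p * k)"
    by (simp only: power_Suc k) (simp add: algebra_simps power2_eq_square power3_eq_cube)
  then show ?case by blast
qed (simp add: numeral_2_eq_2)

text \<open>The hypothesis on Aut(G), phrased for injective endomorphisms and with its exponent
  already identified as \<open>p\<close>; \<open>nonabelian_p_group_autI\<close> justifies
  this.\<close>

locale nonabelian_p_group_aut = class2_p_group +
  assumes aut_commute: "\<And>\<sigma> \<tau> x. \<lbrakk>\<sigma> \<in> hom G G; inj_on \<sigma> (carrier G); \<tau> \<in> hom G G; inj_on \<tau> (carrier G);
      x \<in> carrier G\<rbrakk> \<Longrightarrow> \<sigma> (\<tau> x) = \<tau> (\<sigma> x)"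
    and aut_pow: "\<And>\<sigma> x. \<lbrakk>\<sigma> \<in> hom G G; inj_on \<sigma> (carrier G); x \<in> carrier G\<rbrakk> \<Longrightarrow> (\<sigma> ^^ p) x = x"
    and nonabelian: "center G \<noteq> carrier G"
begin

text \<open>A self-inverse endomorphism is injective, and its order divides both 2 and the odd
  number \<open>p\<close>.\<close>

lemma involution_trivial:
  assumes "\<sigma> \<in> hom G G" and inv: "\<And>x. x \<in> carrier G \<Longrightarrow> \<sigma> (\<sigma> x) = x" and x: "x \<in> carrier G"
  shows "\<sigma> x = x"
proof -
  have "inj_on \<sigma> (carrier G)" by (rule inj_on_inverseI[of _ \<sigma>]) (rule inv)
  then have "(\<sigma> ^^ p) x = x" by (rule aut_pow[OF assms(1) _ x])
  then show ?thesis using inv[OF x] odd by (rule involution_eq_id)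
qed

text \<open>If \<^term>\<open>z\<close> in \<^term>\<open>Omega\<close> avoids a maximal subgroup \<^term>\<open>M\<close>, then the group is the
  direct product of \<^term>\<open>M\<close> and the subgroup of \<^term>\<open>z\<close>, and inverting the second factor is an
  automorphism of order 2.\<close>

lemma Omega_subset_frattini: "Omega \<subseteq> frattini G"
proof
  fix z assume z: "z \<in> Omega"
  have zc: "z \<in> carrier G" using z by simp
  have "z \<in> M" if M: "maximal_subgroup M G" for M
  proof (rule ccontr)
    assume zM: "z \<notin> M"
    have Ms: "subgroup M G" using M by (simp add: maximal_subgroup_def)
    \<comment> \<open>A transvection multiplies z by a chosen element of \<open>Omega\<close>;
      z^(-2) is chosen so that z goes to its inverse.\<close>
    have zz: "inv (z \<otimes> z) \<in> Omega"
      using subgroup.m_inv_closed[OF Omega_subgroup subgroup.m_closed[OF Omega_subgroup z z]] .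
    obtain \<psi> where \<psi>: "\<psi> \<in> hom G G" "\<And>m. m \<in> M \<Longrightarrow> \<psi> m = m" "\<psi> z = z \<otimes> inv (z \<otimes> z)"
      using transvection[OF M zc zM zz] by metis
    have \<psi>z: "\<psi> z = inv z" unfolding \<psi>(3) using zc by (simp add: inv_mult_group m_assoc[symmetric])
    interpret h: group_hom G G \<psi> by (intro group_hom.intro group_hom_axioms.intro is_group \<psi>(1))
    have "\<psi> (\<psi> x) = x" if x: "x \<in> carrier G" for x
    proof -
      obtain m i where m: "m \<in> M" "x = m \<otimes> z [^] (i::nat)"
        by (rule maximal_subgroup_adjoin[OF M zc zM disjI1[OF derived_subset_maximal[OF M]] x])
      have mc: "m \<in> carrier G" using m(1) by (rule subgroup.mem_carrier[OF Ms])
      show ?thesis unfolding m(2) using mc zc \<psi>(2)[OF m(1)] \<psi>z by (simp add: h.hom_nat_pow)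
    qed
    then have "inv z = z" using involution_trivial[OF \<psi>(1) _ zc] \<psi>z by simp
    then have "z [^] (2::nat) = \<one>" using r_inv[OF zc] zc by (simp add: numeral_2_eq_2)
    then have "z = \<one>" using eq_one_of_pow_eq_one[OF zc _ not_dvd_2] by blast
    then show False using zM subgroup.one_closed[OF Ms] by simp
  qed
  then show "z \<in> frattini G" using zc unfolding frattini_def by blast
qed

lemma central_endo:
  assumes g: "g \<in> hom G G" "\<And>x. x \<in> carrier G \<Longrightarrow> g x \<in> center G"
  shows "(\<lambda>x. x \<otimes> g x) \<in> hom G G"
proof (rule homI)
  fix x y assume x: "x \<in> carrier G" and y: "y \<in> carrier G"
  have "x \<otimes> y \<otimes> (g x \<otimes> g y) = x \<otimes> (g x \<otimes> y) \<otimes> g y"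
    using center_commute[OF g(2)[OF x] y] x y endo_closed[OF g(1)] by (simp add: m_assoc)
  then show "x \<otimes> y \<otimes> g (x \<otimes> y) = x \<otimes> g x \<otimes> (y \<otimes> g y)"
    using x y endo_closed[OF g(1)] endo_mult[OF g(1) x y] by (simp add: m_assoc)
qed (use endo_closed[OF g(1)] in simp)

text \<open>Compare with the transvection \<psi> sending t to tc and fixing a maximal subgroup that
  contains Z(G). At t one composite gives t c g(t) g(c), the other t c g(t), because \<psi> fixes
  the central element g(t). Commutativity leaves g(c) = 1.\<close>

lemma central_aut_trivial_on_Omega:
  assumes g: "g \<in> hom G G" "\<And>x. x \<in> carrier G \<Longrightarrow> g x \<in> center G"
    and inj: "inj_on (\<lambda>x. x \<otimes> g x) (carrier G)" and c: "c \<in> Omega"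
  shows "g c = \<one>"
proof -
  obtain M where M: "maximal_subgroup M G" "center G \<subseteq> M"
    using subset_maximal_subgroup[OF fin center_subgroup nonabelian] by blast
  then obtain t where t: "t \<in> carrier G" "t \<notin> M"
    unfolding maximal_subgroup_def using subgroup.subset by blast
  have cM: "c \<in> M" using c M(2) by (auto simp: Omega_def)
  obtain \<psi> where \<psi>: "\<psi> \<in> hom G G" "\<And>m. m \<in> M \<Longrightarrow> \<psi> m = m" "\<psi> t = t \<otimes> c"
    "\<And>x. x \<in> carrier G \<Longrightarrow> \<exists>i::nat. \<psi> x = x \<otimes> c [^] i"
    using transvection[OF M(1) t c] by metis
  have i: "inj_on \<psi> (carrier G)" by (rule transvection_inj[OF M(1) c cM \<psi>(1,2,4)])
  have gt: "g t \<in> center G" "g t \<in> carrier G" using g(2)[OF t(1)] by simp_all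
  have gc: "g c \<in> carrier G" using endo_closed[OF g(1)] c by simp
  have "t \<otimes> c \<otimes> g (t \<otimes> c) = \<psi> (t \<otimes> g t)"
    using aut_commute[OF central_endo[OF g] inj \<psi>(1) i t(1)] \<psi>(3) by simp
  also have "\<dots> = t \<otimes> c \<otimes> g t"
    using endo_mult[OF \<psi>(1) t(1) gt(2)] \<psi>(3) \<psi>(2)[of "g t"] gt(1) M(2) by auto
  finally have "t \<otimes> c \<otimes> (g t \<otimes> g c) = t \<otimes> c \<otimes> g t"
    using endo_mult[OF g(1) t(1)] c by simp
  then have "g t \<otimes> g c = g t" using t(1) c gt(2) gc by simp
  then show ?thesis using gt(2) gc by simp
qed

text \<open>Iterating x -> x^(1+p) p times raises x to the power (1+p)^p and must fix x. Here
  (1+p)^p - 1 is p^2 times a number prime to p.\<close>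

lemma pow_p2_eq_one:
  assumes x: "x \<in> carrier G" shows "x [^] (p\<^sup>2) = \<one>"
proof -
  let ?\<sigma> = "\<lambda>x. x \<otimes> x [^] p"
  have "(\<lambda>x. x [^] p) \<in> hom G G" by (rule homI) (simp_all add: mult_pow_p)
  then have h: "?\<sigma> \<in> hom G G" by (rule central_endo) (rule pow_center)
  have \<sigma>: "?\<sigma> y = y [^] (1 + p)" if "y \<in> carrier G" for y
    using nat_pow_mult[OF that, of 1 p] that by simp
  have "inj_on ?\<sigma> (carrier G)"
  proof (rule inj_onI_hom[OF h])
    fix y assume y: "y \<in> carrier G" "?\<sigma> y = \<one>"
    have "\<not> p dvd 1 + p"
      using prime not_prime_unit dvd_add_left_iff[of p p 1] by auto
    moreover have "y [^] (1 + p) = \<one>" unfolding \<sigma>[OF y(1), symmetric] by (rule y(2))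
    ultimately show "y = \<one>" using eq_one_of_pow_eq_one[OF y(1)] by blast
  qed
  then have "(?\<sigma> ^^ p) x = x" using aut_pow h x by blast
  moreover have "(?\<sigma> ^^ n) x = x [^] ((1 + p) ^ n)" for n
  proof (induction n)
    case (Suc n)
    have "(?\<sigma> ^^ Suc n) x = ?\<sigma> (x [^] ((1 + p) ^ n))" using Suc by simp
    also have "\<dots> = (x [^] ((1 + p) ^ n)) [^] (1 + p)" by (rule \<sigma>) (use x in simp)
    also have "\<dots> = x [^] ((1 + p) ^ n * (1 + p))" by (rule nat_pow_pow[OF x])
    finally show ?case by (simp only: power_Suc2)
  qed (use x in simp)
  ultimately have 1: "x [^] ((1 + p) ^ p) = x" by simp
  obtain k where k: "(1 + p) ^ p = 1 + p * p + (p choose 2) * p\<^sup>2 + p ^ 3 * k"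
    using one_plus_power_expansion by blast
  obtain m where "p = 2 * m + 1" using odd by (rule oddE)
  then have "p choose 2 = p * m" by (simp add: choose_two)
  \<comment> \<open>The term with \<open>p choose 2\<close>, which is p m, already contributes a
    multiple of p^3; so only p^2 survives modulo p^3.\<close>
  then have e: "(1 + p) ^ p = p\<^sup>2 * (1 + p * (m + k)) + 1"
    unfolding k by (simp add: algebra_simps power2_eq_square power3_eq_cube)
  have "x [^] (p\<^sup>2 * (1 + p * (m + k))) \<otimes> x = \<one> \<otimes> x"
    using 1 x unfolding e by simp
  then have "(x [^] (p\<^sup>2)) [^] (1 + p * (m + k)) = \<one>"
    using x by (simp only: right_cancel nat_pow_pow nat_pow_closed one_closed)
  moreover have "\<not> p dvd 1 + p * (m + k)"
    using prime not_prime_unit dvd_add_left_iff[of p "p * (m + k)" 1] by auto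
  ultimately show ?thesis using eq_one_of_pow_eq_one[of "x [^] (p\<^sup>2)"] x by blast
qed

end

section \<open>The non-abelian case\<close>

context nonabelian_p_group_aut
begin

text \<open>In exponent p the identity on Z(G) extends step by step, each new t going to its
  inverse, to an endomorphism \<psi> with x \<psi>(x) always central. It is an involution, hence
  trivial, so every x^2 and then every x is central.\<close>

lemma exists_pow_p_neq_one: "\<exists>x\<in>carrier G. x [^] p \<noteq> \<one>"
proof (rule ccontr)
  assume "\<not> ?thesis"
  then have exp: "x [^] p = \<one>" if "x \<in> carrier G" for x using that by blast
  let ?Q = "\<lambda>x y. x \<otimes> y \<in> center G"
  have id: "(\<lambda>x. x) \<in> hom (G\<lparr>carrier := center G\<rparr>) G" by (auto simp: hom_def)
  have base: "?Q h h" if "h \<in> center G" for h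
    using subgroup.m_closed[OF center_subgroup that that] .
  have mult: "?Q (x \<otimes> x') (y \<otimes> y')"
    if c: "x \<in> carrier G" "x' \<in> carrier G" "y \<in> carrier G" "y' \<in> carrier G" and Q: "?Q x y" "?Q x' y'"
    for x x' y y'
  proof -
    have k: "comm x' y \<in> center G" using c by simp
    have "x \<otimes> x' \<otimes> (y \<otimes> y') = x \<otimes> (x' \<otimes> y) \<otimes> y'" using c by (simp add: m_assoc)
    also have "\<dots> = x \<otimes> comm x' y \<otimes> (y \<otimes> x') \<otimes> y'"
      unfolding comm_swap[OF c(2,3)] using c k by (simp add: m_assoc)
    also have "\<dots> = comm x' y \<otimes> ((x \<otimes> y) \<otimes> (x' \<otimes> y'))"
      unfolding center_commute[OF k c(1), symmetric] using c k by (simp add: m_assoc)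
    finally show ?thesis
      using subgroup.m_closed[OF center_subgroup k subgroup.m_closed[OF center_subgroup Q]] by simp
  qed
  have step: "\<exists>t u. t \<in> carrier G \<and> t \<notin> H \<and> u \<in> carrier G \<and> ?Q t u \<and>
      (\<forall>h\<in>H. \<exists>h'\<in>H. t \<otimes> h = h' \<otimes> t \<and> u \<otimes> \<phi> h = \<phi> h' \<otimes> u) \<and>
      (\<forall>i::nat. t [^] i \<in> H \<longrightarrow> \<phi> (t [^] i) = u [^] i)"
    if H: "subgroup H G" "center G \<subseteq> H" "H \<noteq> carrier G" and \<phi>': "\<phi> \<in> hom (G\<lparr>carrier := H\<rparr>) G"
      "\<forall>h\<in>center G. \<phi> h = h" "\<forall>h\<in>H. ?Q h (\<phi> h)" for H \<phi>
  proof -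
    note \<phi> = \<phi>'(1) bspec[OF \<phi>'(2)] bspec[OF \<phi>'(3)]
    obtain t where t: "t \<in> carrier G" "t \<notin> H" using H(1,3) subgroup.subset by blast
    have DH: "derived G (carrier G) \<subseteq> H" using derived_subset_center H(2) by blast
    have "\<exists>h'\<in>H. t \<otimes> h = h' \<otimes> t \<and> inv t \<otimes> \<phi> h = \<phi> h' \<otimes> inv t" if h: "h \<in> H" for h
    proof -
      note hc = subgroup.mem_carrier[OF H(1) h]
      have y: "\<phi> h \<in> carrier G" using \<phi>(1) h by (auto simp: hom_def)
      let ?k = "comm t h"
      have k: "?k \<in> center G" "?k \<in> H" "?k \<in> carrier G" using t(1) hc H(2) by auto
      \<comment> \<open>Modulo the center \<phi> inverts h, so [\<phi>(h),t] = [h,t]^(-1) = [t,h].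
        Therefore inverting t as well leaves the commutator unchanged, as the extension
        requires.\<close>
      have "comm (h \<otimes> \<phi> h) t = \<one>" by (rule comm_center_left[OF \<phi>(3)[OF h] t(1)])
      then have "comm h t \<otimes> comm (\<phi> h) t = comm h t \<otimes> ?k"
        using comm_mult_left[OF hc y t(1)] comm_inverse[OF hc t(1)] by simp
      then have eq: "comm (\<phi> h) t = ?k" using hc t(1) y by simp
      have "inv t \<otimes> \<phi> h = inv t \<otimes> (\<phi> h \<otimes> t) \<otimes> inv t" using t(1) y by (simp add: m_assoc)
      also have "\<dots> = (inv t \<otimes> ?k) \<otimes> (t \<otimes> \<phi> h) \<otimes> inv t"
        unfolding comm_swap[OF y t(1)] eq using t(1) y k by (simp add: m_assoc)
      also have "\<dots> = ?k \<otimes> (inv t \<otimes> t) \<otimes> \<phi> h \<otimes> inv t"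
        unfolding center_commute[OF k(1) inv_closed[OF t(1)], symmetric]
        by (simp only: m_assoc m_closed inv_closed t(1) y k(3))
      also have "\<dots> = ?k \<otimes> \<phi> h \<otimes> inv t" using t(1) y k by simp
      also have "?k \<otimes> \<phi> h = \<phi> (?k \<otimes> h)"
        using \<phi>(1) k h \<phi>(2)[OF k(1)] by (auto simp: hom_def)
      finally show ?thesis using normalizes[OF H(1) DH t(1) h] by blast
    qed
    moreover have "\<phi> (t [^] i) = inv t [^] i" if "t [^] i \<in> H" for i :: nat
    proof -
      have i: "p dvd i" using mem_of_pow_mem[OF H(1) t(1) that] t(2) by blast
      have "t [^] i = \<one>" "inv t [^] i = \<one>"
        using pow_eq_one_of_dvd[OF _ exp i] t(1) by auto
      then show ?thesis using \<phi>(2)[OF subgroup.one_closed[OF center_subgroup]] by simp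
    qed
    moreover have "?Q t (inv t)" using t(1) subgroup.one_closed[OF center_subgroup] by simp
    ultimately show ?thesis using t by (intro exI[of _ t] exI[of _ "inv t"] conjI) auto
  qed
  have "\<exists>\<psi>. \<psi> \<in> hom G G \<and> (\<forall>h\<in>center G. \<psi> h = h) \<and> (\<forall>x\<in>carrier G. ?Q x (\<psi> x))"
    by (rule hom_extend_carrier[where Q = ?Q, OF fin center_subgroup id base mult step])
  then obtain \<psi> where \<psi>: "\<psi> \<in> hom G G" "\<And>h. h \<in> center G \<Longrightarrow> \<psi> h = h" "\<And>x. x \<in> carrier G \<Longrightarrow> ?Q x (\<psi> x)"
    by blast
  have \<psi>\<psi>: "\<psi> (\<psi> x) = x" if x: "x \<in> carrier G" for x
  proof -
    have c: "\<psi> x \<in> carrier G" by (rule endo_closed[OF \<psi>(1) x])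
    then have cc: "\<psi> (\<psi> x) \<in> carrier G" by (rule endo_closed[OF \<psi>(1)])
    \<comment> \<open>\<psi> fixes the central element x \<psi>(x). Its centrality also makes x
      commute with \<psi>(x), so x can be compared with \<psi>(\<psi>(x)).\<close>
    have "\<psi> x \<otimes> \<psi> (\<psi> x) = x \<otimes> \<psi> x"
      using endo_mult[OF \<psi>(1) x c] \<psi>(2)[OF \<psi>(3)[OF x]] by simp
    also have "\<dots> = \<psi> x \<otimes> x"
    proof -
      have "comm x (\<psi> x) = \<one>"
      proof -
        have "\<one> = comm (x \<otimes> \<psi> x) (\<psi> x)" by (rule comm_center_left[OF \<psi>(3)[OF x] c, symmetric])
        also have "\<dots> = comm x (\<psi> x) \<otimes> comm (\<psi> x) (\<psi> x)" by (rule comm_mult_left[OF x c c])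
        also have "comm (\<psi> x) (\<psi> x) = \<one>" using c by (simp add: comm_def m_assoc)
        finally show ?thesis using x c by simp
      qed
      then show ?thesis using comm_swap[OF x c] x c by simp
    qed
    finally show ?thesis using x c cc by simp
  qed
  have "x \<in> center G" if x: "x \<in> carrier G" for x
  proof -
    have "x [^] (2::nat) \<in> center G"
      using \<psi>(3)[OF x] involution_trivial[OF \<psi>(1) \<psi>\<psi> x] x by (simp add: numeral_2_eq_2)
    then show ?thesis using mem_of_pow_mem[OF center_subgroup x _ not_dvd_2] by blast
  qed
  then show False using nonabelian subgroup.subset[OF center_subgroup] by blast
qed

text \<open>If x^p is not 1, any exponent e of the group is divisible by p because of x, and e/p is
  divisible by p because of x^p.\<close>

lemma group_exponent_eq: "group_exponent G = p\<^sup>2"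
  unfolding group_exponent_def
proof (rule Least_equality)
  show "0 < p\<^sup>2 \<and> (\<forall>x\<in>carrier G. x [^] p\<^sup>2 = \<one>)"
    using pow_p2_eq_one prime prime_gt_0_nat by auto
  fix e :: nat assume e: "0 < e \<and> (\<forall>x\<in>carrier G. x [^] e = \<one>)"
  obtain x where x: "x \<in> carrier G" "x [^] p \<noteq> \<one>" using exists_pow_p_neq_one by blast
  have xe: "x [^] e = \<one>" using e x(1) by blast
  have "p dvd e"
  proof (rule ccontr)
    assume "\<not> p dvd e"
    then have "x = \<one>" by (rule eq_one_of_pow_eq_one[OF x(1) xe])
    then show False using x(2) by simp
  qed
  then obtain j where j: "e = p * j" by (rule dvdE)
  have "(x [^] p) [^] j = \<one>" using xe x(1) by (simp add: j nat_pow_pow)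
  then have "p dvd j" using eq_one_of_pow_eq_one[of "x [^] p" j] x by blast
  then have "p\<^sup>2 dvd e" unfolding j power2_eq_square by simp
  then show "p\<^sup>2 \<le> e" using e by (intro dvd_imp_le) auto
qed

text \<open>Modulo the derived subgroup, \<open>x\<^sub>0\<close> has order p^2, as does w, so
  \<open>x\<^sub>0\<close> may be sent to w. The map extends to G because the cyclic group of order
  p^2 is injective among abelian groups of exponent dividing p^2.\<close>

lemma hom_onto_central_cyclic:
  assumes x\<^sub>0: "x\<^sub>0 \<in> carrier G" "x\<^sub>0 [^] p \<notin> derived G (carrier G)"
    and w: "w \<in> center G" "w [^] p \<noteq> \<one>"
  obtains g where "g \<in> hom G G" "g x\<^sub>0 = w" "\<And>x. x \<in> carrier G \<Longrightarrow> \<exists>i::nat. g x = w [^] i"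
proof -
  let ?D = "derived G (carrier G)"
  have wc: "w \<in> carrier G" using w by simp
  have wp: "w [^] (p * p) = \<one>" using pow_p2_eq_one[OF wc] by (simp add: power2_eq_square)
  have wZ: "w [^] (i::nat) \<in> center G" for i by (rule pow_mem_subgroup[OF center_subgroup w(1)])
  have 1: "(\<lambda>_. \<one>) \<in> hom (G\<lparr>carrier := ?D\<rparr>) G" by (simp add: hom_def)
  have 2: "\<exists>h'\<in>?D. x\<^sub>0 \<otimes> h = h' \<otimes> x\<^sub>0 \<and> w \<otimes> \<one> = \<one> \<otimes> w" if h: "h \<in> ?D" for h
    using normalizes[OF derived_subgroup subset_refl x\<^sub>0(1) h] wc by auto
  \<comment> \<open>Such an exponent is divisible by p^2: p is extracted once using
    \<open>x\<^sub>0\<close> and once more using its p-th power.\<close>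
  have 3: "\<one> = w [^] i" if i: "x\<^sub>0 [^] i \<in> ?D" for i :: nat
  proof -
    have "p dvd i"
    proof (rule ccontr)
      assume "\<not> p dvd i"
      then have "x\<^sub>0 \<in> ?D" by (rule mem_of_pow_mem[OF derived_subgroup x\<^sub>0(1) i])
      then show False using x\<^sub>0(2) pow_mem_subgroup[OF derived_subgroup] by blast
    qed
    then obtain j where j: "i = p * j" by (rule dvdE)
    have "(x\<^sub>0 [^] p) [^] j \<in> ?D" using i x\<^sub>0(1) by (simp add: j nat_pow_pow)
    then have "p dvd j"
      using mem_of_pow_mem[OF derived_subgroup nat_pow_closed[OF x\<^sub>0(1)], of p j] x\<^sub>0(2) by blast
    then obtain k where "i = p * p * k" using j by (auto elim: dvdE)
    then have "w [^] i = (w [^] (p * p)) [^] k" using wc by (simp add: nat_pow_pow)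
    then show ?thesis using wp by simp
  qed
  obtain K \<phi>\<^sub>0 where K: "subgroup K G" "?D \<subseteq> K" "x\<^sub>0 \<in> K"
    "K = {h \<otimes> x\<^sub>0 [^] i | h (i::nat). h \<in> ?D}"
    "\<phi>\<^sub>0 \<in> hom (G\<lparr>carrier := K\<rparr>) G" "\<forall>h\<in>?D. \<phi>\<^sub>0 h = \<one>" "\<phi>\<^sub>0 x\<^sub>0 = w"
    "\<forall>h\<in>?D. \<forall>i::nat. \<phi>\<^sub>0 (h \<otimes> x\<^sub>0 [^] i) = \<one> \<otimes> w [^] i"
    by (rule hom_extend[OF fin derived_subgroup x\<^sub>0(1) wc 1 2 3])
  let ?Q = "\<lambda>x y. \<exists>i::nat. y = w [^] i"
  have base: "?Q x (\<phi>\<^sub>0 x)" if x: "x \<in> K" for x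
  proof -
    obtain h i where "h \<in> ?D" "x = h \<otimes> x\<^sub>0 [^] (i::nat)" using x unfolding K(4) by blast
    then have "\<phi>\<^sub>0 x = w [^] i" using K(8) wc by simp
    then show ?thesis by blast
  qed
  have mult: "?Q (x \<otimes> x') (y \<otimes> y')" if Q: "?Q x y" "?Q x' y'" for x x' y y'
    using Q nat_pow_mult[OF wc] by metis
  have step: "\<exists>t u. t \<in> carrier G \<and> t \<notin> H \<and> u \<in> carrier G \<and> ?Q t u \<and>
      (\<forall>h\<in>H. \<exists>h'\<in>H. t \<otimes> h = h' \<otimes> t \<and> u \<otimes> \<phi> h = \<phi> h' \<otimes> u) \<and>
      (\<forall>i::nat. t [^] i \<in> H \<longrightarrow> \<phi> (t [^] i) = u [^] i)"
    if H: "subgroup H G" "K \<subseteq> H" "H \<noteq> carrier G" and \<phi>': "\<phi> \<in> hom (G\<lparr>carrier := H\<rparr>) G"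
      "\<forall>h\<in>K. \<phi> h = \<phi>\<^sub>0 h" "\<forall>h\<in>H. ?Q h (\<phi> h)" for H \<phi>
  proof -
    note \<phi> = \<phi>'(1) bspec[OF \<phi>'(2)] bspec[OF \<phi>'(3)]
    have DH: "?D \<subseteq> H" using K(2) H(2) by blast
    have \<phi>m: "\<phi> (h \<otimes> k) = \<phi> h \<otimes> \<phi> k" if "h \<in> H" "k \<in> H" for h k
      using \<phi>(1) that by (auto simp: hom_def)
    have \<phi>c: "\<phi> h \<in> carrier G" if "h \<in> H" for h using \<phi>(1) that by (auto simp: hom_def)
    have \<phi>1: "\<phi> h = \<one>" if "h \<in> ?D" for h using \<phi>(2) K(2,6) that by auto
    have \<phi>p: "\<phi> (h [^] k) = \<phi> h [^] k" if h: "h \<in> H" for h and k :: nat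
    proof (induction k)
      case 0
      show ?case using \<phi>1[OF subgroup.one_closed[OF derived_subgroup]] by simp
    next
      case (Suc k)
      show ?case using \<phi>m[OF pow_mem_subgroup[OF H(1) h] h] Suc by simp
    qed
    obtain y where y: "y \<in> carrier G" "y \<notin> H" using H(1,3) subgroup.subset by blast
    \<comment> \<open>Either y or y^p serves, since y^(p^2) = 1 lies in \<open>H\<close>.\<close>
    have "\<exists>t. t \<in> carrier G \<and> t \<notin> H \<and> t [^] p \<in> H"
    proof (cases "y [^] p \<in> H")
      case False
      have "(y [^] p) [^] p = \<one>"
        using pow_p2_eq_one[OF y(1)] y(1) by (simp add: nat_pow_pow power2_eq_square)
      then show ?thesis using False y(1) subgroup.one_closed[OF H(1)] by (metis nat_pow_closed)
    qed (use y in blast)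
    then obtain t where t: "t \<in> carrier G" "t \<notin> H" "t [^] p \<in> H" by blast
    obtain i :: nat where i: "\<phi> (t [^] p) = w [^] i" using \<phi>(3)[OF t(3)] by blast
    have "(t [^] p) [^] p = \<one>"
      using pow_p2_eq_one[OF t(1)] t(1) by (simp add: nat_pow_pow power2_eq_square)
    then have "(w [^] i) [^] p = \<one>"
      using \<phi>p[OF t(3), of p] \<phi>1[OF subgroup.one_closed[OF derived_subgroup]] i by simp
    then have "(w [^] p) [^] i = \<one>" using wc by (simp add: nat_pow_pow mult.commute)
    then have "p dvd i" using eq_one_of_pow_eq_one[of "w [^] p" i] w(2) wc by blast
    then obtain j where j: "i = p * j" by (rule dvdE)
    \<comment> \<open>A p-th root of \<phi>(t^p) inside the subgroup of w; it exists because
      \<phi>(t^p) has order dividing p, which forced p to divide i.\<close>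
    let ?u = "w [^] j"
    have "\<exists>h'\<in>H. t \<otimes> h = h' \<otimes> t \<and> ?u \<otimes> \<phi> h = \<phi> h' \<otimes> ?u" if h: "h \<in> H" for h
    proof -
      have hc: "h \<in> carrier G" by (rule subgroup.mem_carrier[OF H(1) h])
      have k: "comm t h \<in> ?D" by (rule comm_in_derived[OF t(1) hc])
      have "\<phi> (comm t h \<otimes> h) = \<phi> h" using \<phi>m[of "comm t h" h] k DH h \<phi>1[OF k] \<phi>c[OF h] by auto
      then show ?thesis
        using normalizes[OF H(1) DH t(1) h] center_commute[OF wZ \<phi>c[OF h]] by auto
    qed
    moreover have "\<phi> (t [^] k) = ?u [^] k" if k: "t [^] k \<in> H" for k :: nat
    proof -
      have "p dvd k" using mem_of_pow_mem[OF H(1) t(1) k] t(2) by blast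
      then obtain l where l: "k = p * l" by (rule dvdE)
      have "\<phi> (t [^] k) = (w [^] i) [^] l"
        using \<phi>p[OF t(3), of l] i t(1) by (simp add: l nat_pow_pow)
      also have "\<dots> = ?u [^] k" using wc by (simp add: j l nat_pow_pow ac_simps)
      finally show ?thesis .
    qed
    moreover have "?Q t ?u" by blast
    ultimately show ?thesis using t wc by (intro exI[of _ t] exI[of _ ?u] conjI) auto
  qed
  have "\<exists>g. g \<in> hom G G \<and> (\<forall>h\<in>K. g h = \<phi>\<^sub>0 h) \<and> (\<forall>x\<in>carrier G. ?Q x (g x))"
    by (rule hom_extend_carrier[where Q = ?Q, OF fin K(1,5) base mult step])
  then obtain g where g: "g \<in> hom G G" "\<And>h. h \<in> K \<Longrightarrow> g h = \<phi>\<^sub>0 h" "\<And>x. x \<in> carrier G \<Longrightarrow> ?Q x (g x)"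
    by blast
  show ?thesis by (rule that[OF g(1) _ g(3)]) (use g(2) K(3,7) in auto)
qed

text \<open>In a cyclic group of order dividing p^2 every nontrivial subgroup contains the p-th
  powers.\<close>

lemma cyclic_p2_bottom:
  assumes w: "w \<in> carrier G" and x: "x = w [^] (i::nat)" "x \<noteq> \<one>"
  shows "\<exists>k::nat. w [^] p = x [^] k"
proof -
  define H where "H = {x [^] k | k::nat. True}"
  have xc: "x \<in> carrier G" using w x(1) by simp
  have HI: "x [^] k \<in> H" for k :: nat unfolding H_def by blast
  have Hs: "subgroup H G"
  proof (rule finite_subgroupI[OF fin])
    show "\<one> \<in> H" using HI[of 0] by simp
    show "a \<otimes> b \<in> H" if "a \<in> H" "b \<in> H" for a b
      using that nat_pow_mult[OF xc] unfolding H_def by blast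
  qed (use xc in \<open>auto simp: H_def\<close>)
  have xH: "x \<in> H" using HI[of 1] xc by simp
  have "w [^] p \<in> H"
  proof (cases "p dvd i")
    case False
    have "w \<in> H" by (rule mem_of_pow_mem[OF Hs w _ False]) (use x(1) xH in simp)
    then show ?thesis by (rule pow_mem_subgroup[OF Hs])
  next
    case True
    then obtain j where j: "i = p * j" by (rule dvdE)
    have xj: "x = (w [^] p) [^] j" using x(1) w by (simp add: j nat_pow_pow)
    have "\<not> p dvd j"
    proof
      assume "p dvd j"
      then obtain k where "i = p\<^sup>2 * k" using j by (auto elim: dvdE simp: power2_eq_square)
      then have "x = (w [^] p\<^sup>2) [^] k" using x(1) w by (simp add: nat_pow_pow)
      then show False using x(2) pow_p2_eq_one[OF w] by simp
    qed
    then show ?thesis by (intro mem_of_pow_mem[OF Hs nat_pow_closed[OF w]]) (use xj xH in simp_all)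
  qed
  then show ?thesis unfolding H_def by blast
qed

text \<open>For a homomorphism \<^term>\<open>g\<close> into the subgroup of \<^term>\<open>w\<close>, the map
  \<open>x \<mapsto> x g(x)\<close> can only fail to be injective at \<open>w\<^sup>p\<close>; if it does, its square \<open>g\<^sup>2\<close> is used instead.\<close>

lemma center_subset_Omega:
  assumes x\<^sub>0: "x\<^sub>0 \<in> carrier G" "x\<^sub>0 [^] p \<notin> derived G (carrier G)"
  shows "center G \<subseteq> Omega"
proof (rule ccontr)
  assume "\<not> center G \<subseteq> Omega"
  then obtain w where w: "w \<in> center G" "w [^] p \<noteq> \<one>" unfolding Omega_def by blast
  have wc: "w \<in> carrier G" using w by simp
  have wZ: "w [^] (i::nat) \<in> center G" for i by (rule pow_mem_subgroup[OF center_subgroup w(1)])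
  have pp: "(x [^] p) [^] p = \<one>" if "x \<in> carrier G" for x
    using pow_p2_eq_one[OF that] that by (simp add: nat_pow_pow power2_eq_square)
  \<comment> \<open>If x -> x g(x) does not kill w^p, it is injective, hence an automorphism, and g
    must vanish on \<open>x\<^sub>0 [^] p\<close>, an element of \<open>Omega\<close>.\<close>
  have no: "g (x\<^sub>0 [^] p) = \<one>"
    if g: "g \<in> hom G G" "\<And>x. x \<in> carrier G \<Longrightarrow> \<exists>i::nat. g x = w [^] i"
      and gv: "w [^] p \<otimes> g (w [^] p) \<noteq> \<one>" for g
  proof (rule central_aut_trivial_on_Omega[OF g(1)])
    show cen: "g x \<in> center G" if "x \<in> carrier G" for x using g(2)[OF that] wZ by metis
    note h = central_endo[OF g(1) cen]
    show "inj_on (\<lambda>x. x \<otimes> g x) (carrier G)"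
    proof (rule inj_onI_hom[OF h])
      fix x assume x: "x \<in> carrier G" "x \<otimes> g x = \<one>"
      have gx: "g x \<in> carrier G" by (rule endo_closed[OF g(1) x(1)])
      obtain i :: nat where i: "g x = w [^] i" using g(2)[OF x(1)] by blast
      show "x = \<one>"
      proof (rule ccontr)
        assume "x \<noteq> \<one>"
        have gn: "g x \<noteq> \<one>" using x \<open>x \<noteq> \<one>\<close> by auto
        \<comment> \<open>For x in the kernel, g(x) is the inverse of x; so w^p is a power of x and
          belongs to the kernel too, against \<open>gv\<close>.\<close>
        obtain k :: nat where k: "w [^] p = g x [^] k" using cyclic_p2_bottom[OF wc i gn] by blast
        have "x = inv (g x)" using inv_equality[OF x(2) gx x(1)] by simp
        then have ginv: "g x = inv x" using gx by (metis inv_inv)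
        have v: "w [^] p = inv (x [^] k)" unfolding k ginv by (rule nat_pow_inv[OF x(1)])
        have "x [^] k \<otimes> g (x [^] k) = \<one>"
          unfolding endo_pow[OF g(1) x(1)] k[symmetric] v using x(1) by simp
        moreover have "g (inv (x [^] k)) = inv (g (x [^] k))"
          using group_hom.hom_inv[of G G g "x [^] k"] g(1) x(1) is_group
          by (simp add: group_hom_def group_hom_axioms_def)
        moreover have "g (x [^] k) = inv (x [^] k)" unfolding endo_pow[OF g(1) x(1)] k[symmetric] by (rule v)
        ultimately have "w [^] p \<otimes> g (w [^] p) = \<one>" unfolding v using x(1) by simp
        then show False using gv by simp
      qed
    qed
    show "x\<^sub>0 [^] p \<in> Omega" using pow_center[OF x\<^sub>0(1)] pp[OF x\<^sub>0(1)] by (simp add: Omega_def)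
  qed
  obtain g where g: "g \<in> hom G G" "g x\<^sub>0 = w" "\<And>x. x \<in> carrier G \<Longrightarrow> \<exists>i::nat. g x = w [^] i"
    using hom_onto_central_cyclic[OF x\<^sub>0 w] by metis
  let ?v = "w [^] p"
  have gx0: "g (x\<^sub>0 [^] p) = ?v" using endo_pow[OF g(1) x\<^sub>0(1)] g(2) by simp
  then have gv: "?v \<otimes> g ?v = \<one>" using no[OF g(1,3)] w(2) by metis
  have vc: "?v \<in> carrier G" using wc by simp
  have gvc: "g ?v \<in> carrier G" by (rule endo_closed[OF g(1) vc])
  \<comment> \<open>The square is pointwise, not a composite. Since v g(v) = 1, the element v f(v)
    equals g(v), which is nontrivial; so \<open>no\<close> applies to f and gives v^2 = 1.\<close>
  let ?f = "\<lambda>x. g x \<otimes> g x"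
  have f: "?f \<in> hom G G"
  proof (rule homI)
    fix x y assume x: "x \<in> carrier G" and y: "y \<in> carrier G"
    note gc = endo_closed[OF g(1) x] endo_closed[OF g(1) y]
    have "g x \<in> center G" using g(3)[OF x] wZ by metis
    then have "g x \<otimes> g y = g y \<otimes> g x" using gc(2) by (rule center_commute)
    then have "g x \<otimes> (g y \<otimes> g x) \<otimes> g y = g x \<otimes> (g x \<otimes> g y) \<otimes> g y" by simp
    then show "g (x \<otimes> y) \<otimes> g (x \<otimes> y) = g x \<otimes> g x \<otimes> (g y \<otimes> g y)"
      unfolding endo_mult[OF g(1) x y] using gc by (simp only: m_assoc m_closed)
  qed (use endo_closed[OF g(1)] in simp)
  have fQ: "\<exists>i::nat. ?f x = w [^] i" if x: "x \<in> carrier G" for x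
    using g(3)[OF x] nat_pow_mult[OF wc] by metis
  have "?v \<otimes> ?f ?v = g ?v" using gv vc gvc by (simp add: m_assoc[symmetric])
  moreover have "g ?v \<noteq> \<one>" using gv vc w(2) by auto
  ultimately have "?f (x\<^sub>0 [^] p) = \<one>" using no[OF f fQ] by metis
  then have "?v [^] (2::nat) = \<one>" using gx0 vc by (simp add: numeral_2_eq_2)
  then show False using eq_one_of_pow_eq_one[OF vc _ not_dvd_2] w(2) by blast
qed

text \<open>If some p-th power is outside the derived subgroup, Z(G), \<open>Omega\<close> and
  Phi(G) coincide through a cycle of inclusions. Otherwise Phi(G), generated by p-th powers and
  commutators, lies in the derived subgroup, which lies in \<open>Omega\<close> and so in
  Phi(G).\<close>

lemma frattini_cases:
  "(center G = frattini G \<and> elementary_abelian (G\<lparr>carrier := frattini G\<rparr>)) \<or>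
   (derived G (carrier G) = frattini G \<and> elementary_abelian (G\<lparr>carrier := frattini G\<rparr>))"
proof (cases "\<exists>x\<in>carrier G. x [^] p \<notin> derived G (carrier G)")
  case True
  then obtain x where "x \<in> carrier G" "x [^] p \<notin> derived G (carrier G)" by blast
  then have Z: "center G \<subseteq> Omega" by (rule center_subset_Omega)
  have "frattini G \<subseteq> center G"
  proof
    fix y assume "y \<in> frattini G"
    then obtain x c where xc: "y = x [^] p \<otimes> c" "x \<in> carrier G" "c \<in> derived G (carrier G)"
      unfolding frattini_eq by blast
    then have "c \<in> center G" using derived_subset_center by blast
    then show "y \<in> center G"
      unfolding xc(1) by (rule subgroup.m_closed[OF center_subgroup pow_center[OF xc(2)]])
  qed
  then have "center G = frattini G" using Z Omega_subset_frattini by blast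
  then show ?thesis using elementary_abelian_subgroup[OF center_subgroup Z] by simp
next
  case False
  have "derived G (carrier G) = frattini G"
  proof
    show "frattini G \<subseteq> derived G (carrier G)"
    proof
      fix y assume "y \<in> frattini G"
      then obtain x c where xc: "y = x [^] p \<otimes> c" "x \<in> carrier G" "c \<in> derived G (carrier G)"
        unfolding frattini_eq by blast
      have "x [^] p \<in> derived G (carrier G)" using False xc(2) by blast
      then show "y \<in> derived G (carrier G)"
        unfolding xc(1) by (rule subgroup.m_closed[OF derived_subgroup _ xc(3)])
    qed
    show "derived G (carrier G) \<subseteq> frattini G"
      using derived_subset_Omega Omega_subset_frattini by blast
  qed
  then show ?thesis using elementary_abelian_subgroup[OF derived_subgroup derived_subset_Omega] by simp
qed

end

section \<open>Conclusion\<close>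

context odd_p_group
begin

section \<open>The abelian case\<close>

lemma abelian_class2:
  assumes ab: "center G = carrier G"
  shows "class2_p_group G p"
proof
  fix x y assume "x \<in> carrier G" "y \<in> carrier G"
  then show "x \<otimes> y \<otimes> inv x \<otimes> inv y \<in> center G" unfolding ab by simp
qed (simp add: ab)

text \<open>Inversion has order 2 in a nontrivial abelian group of odd order, so q is 2. Squaring is
  then an automorphism whose second iterate x -> x^4 is the identity.\<close>

lemma abelian_aut_exponent:
  assumes ab: "center G = carrier G" and q: "Factorial_Ring.prime q"
    and exp: "\<And>\<sigma> x. \<lbrakk>\<sigma> \<in> hom G G; inj_on \<sigma> (carrier G); x \<in> carrier G\<rbrakk> \<Longrightarrow> (\<sigma> ^^ q) x = x"
    and x: "x \<in> carrier G" "x \<noteq> \<one>"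
  shows "q = 2" "x [^] (3::nat) = \<one>"
proof -
  have com: "a \<otimes> b = b \<otimes> a" if "a \<in> carrier G" "b \<in> carrier G" for a b
    using ab that unfolding center_def by blast
  have inv: "m_inv G \<in> hom G G"
  proof (rule homI)
    fix a b assume a: "a \<in> carrier G" and b: "b \<in> carrier G"
    show "inv (a \<otimes> b) = inv a \<otimes> inv b"
      unfolding inv_mult_group[OF a b] using a b by (intro com) simp_all
  qed simp
  have "inj_on (m_inv G) (carrier G)" by (rule inj_on_inverseI[of _ "m_inv G"]) simp
  then have qx: "(m_inv G ^^ q) x = x" by (rule exp[OF inv _ x(1)])
  show q2: "q = 2"
  proof (rule ccontr)
    assume "q \<noteq> 2"
    then have "odd q" using q primes_dvd_imp_eq two_is_prime_nat by blast
    then have "inv x = x" using involution_eq_id[OF qx] x(1) by simp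
    then have "x [^] (2::nat) = \<one>" using r_inv[OF x(1)] x(1) by (simp add: numeral_2_eq_2)
    then show False using eq_one_of_pow_eq_one[OF x(1) _ not_dvd_2] x(2) by blast
  qed
  let ?d = "\<lambda>x. x \<otimes> x"
  have d: "?d \<in> hom G G"
  proof (rule homI)
    fix a b assume a: "a \<in> carrier G" and b: "b \<in> carrier G"
    have "a \<otimes> b \<otimes> (a \<otimes> b) = a \<otimes> (b \<otimes> a) \<otimes> b" using a b by (simp add: m_assoc)
    then show "a \<otimes> b \<otimes> (a \<otimes> b) = a \<otimes> a \<otimes> (b \<otimes> b)"
      unfolding com[OF b a] using a b by (simp add: m_assoc)
  qed simp
  have "inj_on ?d (carrier G)"
  proof (rule inj_onI_hom[OF d])
    fix y assume y: "y \<in> carrier G" "y \<otimes> y = \<one>"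
    then have "y [^] (2::nat) = \<one>" by (simp add: numeral_2_eq_2)
    then show "y = \<one>" by (rule eq_one_of_pow_eq_one[OF y(1) _ not_dvd_2])
  qed
  then have "(?d ^^ q) x = x" by (rule exp[OF d _ x(1)])
  then have "x \<otimes> x \<otimes> x \<otimes> x = \<one> \<otimes> x" using x(1) by (simp add: q2 numeral_2_eq_2 m_assoc)
  then have "x \<otimes> x \<otimes> x = \<one>" using x(1) by (simp only: right_cancel m_closed one_closed)
  then show "x [^] (3::nat) = \<one>" using x(1) by (simp add: numeral_3_eq_3)
qed

lemma abelian_pow_p:
  assumes ab: "center G = carrier G" and q: "Factorial_Ring.prime q"
    and exp: "\<And>\<sigma> x. \<lbrakk>\<sigma> \<in> hom G G; inj_on \<sigma> (carrier G); x \<in> carrier G\<rbrakk> \<Longrightarrow> (\<sigma> ^^ q) x = x"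
    and x: "x \<in> carrier G"
  shows "x [^] p = \<one>" "x \<noteq> \<one> \<Longrightarrow> p = 3"
proof -
  show p3: "p = 3" if "x \<noteq> \<one>"
  proof -
    have "x [^] (3::nat) = \<one>" by (rule abelian_aut_exponent(2)[OF ab q exp x that])
    then have "p dvd 3" using eq_one_of_pow_eq_one[OF x] that by blast
    moreover have "Factorial_Ring.prime (3::nat)" by simp
    ultimately show ?thesis using prime primes_dvd_imp_eq by blast
  qed
  show "x [^] p = \<one>"
  proof (cases "x = \<one>")
    case False
    then show ?thesis using p3 abelian_aut_exponent(2)[OF ab q exp x] by simp
  qed simp
qed

text \<open>The group has exponent dividing p and no nontrivial commutators, so both subgroups are
  trivial.\<close>

lemma abelian_frattini:
  assumes ab: "center G = carrier G" and q: "Factorial_Ring.prime q"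
    and exp: "\<And>\<sigma> x. \<lbrakk>\<sigma> \<in> hom G G; inj_on \<sigma> (carrier G); x \<in> carrier G\<rbrakk> \<Longrightarrow> (\<sigma> ^^ q) x = x"
  shows "derived G (carrier G) = frattini G" "elementary_abelian (G\<lparr>carrier := frattini G\<rparr>)"
proof -
  interpret class2_p_group G p by (rule abelian_class2[OF ab])
  have "comm x y = \<one>" if "x \<in> carrier G" "y \<in> carrier G" for x y
    by (rule comm_center_left) (use that ab in auto)
  then have "derived G (carrier G) \<subseteq> {\<one>}"
    using derived_subset_iff[OF triv_subgroup] by simp
  then have D: "derived G (carrier G) = {\<one>}"
    using subgroup.one_closed[OF derived_subgroup] by blast
  have "frattini G = {\<one>}"
    unfolding frattini_eq D using abelian_pow_p(1)[OF ab q exp] by (auto intro!: exI[of _ \<one>])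
  then show "derived G (carrier G) = frattini G" using D by simp
  then show "elementary_abelian (G\<lparr>carrier := frattini G\<rparr>)"
    using elementary_abelian_subgroup[OF derived_subgroup derived_subset_Omega] by simp
qed

text \<open>If the subgroup of a nontrivial x were proper, a maximal subgroup above it would carry a
  transvection t -> tx of order 3, although automorphisms have order dividing 2. So the group is
  cyclic with at most 3 elements.\<close>

lemma abelian_order:
  assumes ab: "center G = carrier G" and q: "Factorial_Ring.prime q"
    and exp: "\<And>\<sigma> x. \<lbrakk>\<sigma> \<in> hom G G; inj_on \<sigma> (carrier G); x \<in> carrier G\<rbrakk> \<Longrightarrow> (\<sigma> ^^ q) x = x"
  shows "order G = 1 \<or> order G = 3"
proof (cases "\<exists>x\<in>carrier G. x \<noteq> \<one>")
  case False
  then have "carrier G = {\<one>}" by auto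
  then show ?thesis by (simp add: order_def)
next
  case True
  then obtain x where x: "x \<in> carrier G" "x \<noteq> \<one>" by blast
  interpret class2_p_group G p by (rule abelian_class2[OF ab])
  have p: "p = 3" by (rule abelian_pow_p(2)[OF ab q exp x])
  have q2: "q = 2" by (rule abelian_aut_exponent(1)[OF ab q exp x])
  have x3: "x [^] p = \<one>" by (rule abelian_pow_p(1)[OF ab q exp x(1)])
  define H where "H = {h \<otimes> x [^] i | h (i::nat). h \<in> {\<one>}}"
  have xZ: "x \<in> center G" using x(1) ab by simp
  note H = adjoin_subgroup[OF triv_subgroup x(1) disjI2[OF xZ], folded H_def]
  have xO: "x \<in> Omega" using xZ x3 by (simp add: Omega_def)
  have "H = carrier G"
  proof (rule ccontr)
    assume "H \<noteq> carrier G"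
    then obtain M where M: "maximal_subgroup M G" "H \<subseteq> M"
      using subset_maximal_subgroup[OF fin H(1)] by blast
    then obtain t where t: "t \<in> carrier G" "t \<notin> M"
      unfolding maximal_subgroup_def using subgroup.subset by blast
    have xM: "x \<in> M" using H(3) M(2) by blast
    obtain \<psi> where \<psi>: "\<psi> \<in> hom G G" "\<And>m. m \<in> M \<Longrightarrow> \<psi> m = m" "\<psi> t = t \<otimes> x"
      "\<And>x'. x' \<in> carrier G \<Longrightarrow> \<exists>i::nat. \<psi> x' = x' \<otimes> x [^] i"
      using transvection[OF M(1) t xO] by metis
    have "inj_on \<psi> (carrier G)" by (rule transvection_inj[OF M(1) xO xM \<psi>(1,2,4)])
    then have "(\<psi> ^^ q) t = t" by (rule exp[OF \<psi>(1) _ t(1)])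
    then have "t \<otimes> x \<otimes> x = t"
      using \<psi>(2)[OF xM] \<psi>(3) endo_mult[OF \<psi>(1) t(1) x(1)] by (simp add: q2 numeral_2_eq_2)
    then have "x [^] (2::nat) = \<one>" using t(1) x(1) by (simp add: m_assoc numeral_2_eq_2)
    then show False using eq_one_of_pow_eq_one[OF x(1) _ not_dvd_2] x(2) by blast
  qed
  moreover have "H \<subseteq> (\<lambda>i. x [^] i) ` {..<3::nat}"
  proof
    fix y assume "y \<in> H"
    then obtain i :: nat where "y = x [^] i" unfolding H_def using x(1) by auto
    moreover have "x [^] i = (x [^] p) [^] (i div 3) \<otimes> x [^] (i mod 3)"
      using x(1) p by (simp add: nat_pow_pow nat_pow_mult)
    ultimately have "y = x [^] (i mod 3)" using x3 x(1) by simp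
    then show "y \<in> (\<lambda>i. x [^] i) ` {..<3::nat}" by simp
  qed
  ultimately have le: "order G \<le> 3"
    unfolding order_def using surj_card_le[of "{..<3::nat}" "carrier G" "\<lambda>i. x [^] i"] by simp
  obtain n where n: "order G = 3 ^ n" using order_pow p by blast
  have "n \<le> 1"
  proof (rule ccontr)
    assume "\<not> n \<le> 1"
    then have "(3::nat) ^ 2 \<le> 3 ^ n" by (intro power_increasing) auto
    then show False using le n by simp
  qed
  then have "n = 0 \<or> n = 1" by auto
  then show ?thesis using n by auto
qed

text \<open>Inner automorphisms have \<^term>\<open>p\<close>-power order, so the exponent of the automorphism group
  is \<^term>\<open>p\<close>, and the group of inner automorphisms is elementary abelian.\<close>

lemma nonabelian_p_group_autI:
  assumes nab: "center G \<noteq> carrier G" and q: "Factorial_Ring.prime q"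
    and com: "\<And>\<sigma> \<tau> x. \<lbrakk>\<sigma> \<in> hom G G; inj_on \<sigma> (carrier G); \<tau> \<in> hom G G; inj_on \<tau> (carrier G);
      x \<in> carrier G\<rbrakk> \<Longrightarrow> \<sigma> (\<tau> x) = \<tau> (\<sigma> x)"
    and exp: "\<And>\<sigma> x. \<lbrakk>\<sigma> \<in> hom G G; inj_on \<sigma> (carrier G); x \<in> carrier G\<rbrakk> \<Longrightarrow> (\<sigma> ^^ q) x = x"
  shows "nonabelian_p_group_aut G p"
proof -
  let ?c = "\<lambda>g x. g \<otimes> x \<otimes> inv g"
  have c: "?c g \<in> hom G G" if g: "g \<in> carrier G" for g
  proof (rule homI)
    fix x y assume x: "x \<in> carrier G" and y: "y \<in> carrier G"
    have "g \<otimes> x \<otimes> inv g \<otimes> (g \<otimes> y \<otimes> inv g) = g \<otimes> x \<otimes> (inv g \<otimes> g) \<otimes> y \<otimes> inv g"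
      by (simp only: m_assoc m_closed inv_closed g x y)
    then show "g \<otimes> (x \<otimes> y) \<otimes> inv g = g \<otimes> x \<otimes> inv g \<otimes> (g \<otimes> y \<otimes> inv g)"
      using g x y by (simp add: m_assoc)
  qed (use g in simp)
  have i: "inj_on (?c g) (carrier G)" if g: "g \<in> carrier G" for g
    by (rule inj_onI) (use g in simp)
  have pow: "(?c g ^^ n) x = ?c (g [^] n) x" if g: "g \<in> carrier G" and x: "x \<in> carrier G" for g x and n :: nat
  proof (induction n)
    case (Suc n)
    have gs: "g [^] Suc n = g \<otimes> g [^] n" by (rule nat_pow_Suc2[OF g])
    have "(?c g ^^ Suc n) x = g \<otimes> (g [^] n \<otimes> x \<otimes> inv (g [^] n)) \<otimes> inv g" using Suc by simp
    also have "\<dots> = ?c (g [^] Suc n) x"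
      unfolding gs using g x by (simp add: inv_mult_group m_assoc del: nat_pow_Suc)
    finally show ?case .
  qed (use x in simp)
  have centerI: "g \<in> center G" if g: "g \<in> carrier G" and fx: "\<And>x. x \<in> carrier G \<Longrightarrow> ?c g x = x" for g
  proof -
    have "g \<otimes> x = x \<otimes> g" if x: "x \<in> carrier G" for x
    proof -
      have "g \<otimes> x = g \<otimes> x \<otimes> (inv g \<otimes> g)" using g x by simp
      also have "\<dots> = ?c g x \<otimes> g" by (simp only: m_assoc m_closed inv_closed g x)
      also have "\<dots> = x \<otimes> g" using fx[OF x] by simp
      finally show ?thesis .
    qed
    then show ?thesis using g unfolding center_def by blast
  qed
  \<comment> \<open>Conjugation by g^q is the q-th iterate of conjugation by g, hence the
    identity.\<close>
  have powq: "g [^] q \<in> center G" if g: "g \<in> carrier G" for g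
    by (rule centerI) (use g pow[OF g, of _ q] exp[OF c[OF g] i[OF g]] in auto)
  have "p dvd q"
  proof (rule ccontr)
    assume "\<not> p dvd q"
    then have "carrier G \<subseteq> center G" using mem_of_pow_mem[OF center_subgroup _ powq] by blast
    then show False using nab subgroup.subset[OF center_subgroup] by blast
  qed
  then have pq: "p = q" using prime q primes_dvd_imp_eq by blast
  have "g \<otimes> h \<otimes> inv g \<otimes> inv h \<in> center G" if g: "g \<in> carrier G" and h: "h \<in> carrier G" for g h
  proof (rule centerI)
    fix x assume x: "x \<in> carrier G"
    have e: "a \<otimes> (b \<otimes> z \<otimes> inv b) \<otimes> inv a = ?c (a \<otimes> b) z"
      if "a \<in> carrier G" "b \<in> carrier G" "z \<in> carrier G" for a b z
      using that by (simp add: inv_mult_group m_assoc)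
    have cancel: "?c a (?c (inv a) z) = z" if "a \<in> carrier G" "z \<in> carrier G" for a z
      using e[of a "inv a" z] that by simp
    \<comment> \<open>Conjugation by the commutator is a composite of four conjugations; once the
      two outer ones are swapped, everything cancels.\<close>
    have "?c (g \<otimes> h \<otimes> inv g \<otimes> inv h) x = ?c g (?c h (?c (inv g) (?c (inv h) x)))"
      by (simp only: e[symmetric] m_closed inv_closed g h x)
    also have "\<dots> = ?c h (?c g (?c (inv g) (?c (inv h) x)))"
      by (rule com[OF c[OF g] i[OF g] c[OF h] i[OF h]]) (use g h x in simp)
    also have "\<dots> = x" by (simp only: cancel m_closed inv_closed g h x)
    finally show "?c (g \<otimes> h \<otimes> inv g \<otimes> inv h) x = x" .
  qed (use g h in simp)
  then show ?thesis
    using powq com exp nab unfolding pq[symmetric] by unfold_locales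
qed

end

text \<open>Orders 1 and 3 are set apart for the exponent: the trivial group has exponent 1, and the
  group of order 3 has exponent 3 although its automorphism group, of order 2, is elementary
  abelian.\<close>

theorem theorem4p1:
  fixes G :: "('a, 'b) monoid_scheme" and p :: nat
  assumes "Factorial_Ring.prime p" and "odd p"
    and "finite_p_group p G"
    and "elementary_abelian (AutoGroup G)"
  shows "((center G = frattini G \<and> elementary_abelian (G\<lparr>carrier := frattini G\<rparr>)) \<or>
          (derived G (carrier G) = frattini G \<and> elementary_abelian (G\<lparr>carrier := frattini G\<rparr>))) \<and>
         (order G \<noteq> 1 \<and> order G \<noteq> 3 \<longrightarrow> group_exponent G = p\<^sup>2)"
proof -
  interpret odd_p_group G p
    using assms(1-3) unfolding finite_p_group_def odd_p_group_def odd_p_group_axioms_def by simp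
  obtain q where ab: "comm_group (AutoGroup G)" and q: "Factorial_Ring.prime (q::nat)"
    and e: "\<forall>f\<in>carrier (AutoGroup G). f [^]\<^bsub>AutoGroup G\<^esub> q = \<one>\<^bsub>AutoGroup G\<^esub>"
    using assms(4) unfolding elementary_abelian_def by blast
  note exp = AutoGroup_exponent[OF fin e]
  show ?thesis
  proof (cases "center G = carrier G")
    \<comment> \<open>Here the second alternative holds, and \<open>abelian_order\<close> leaves
      only the orders excluded from the exponent claim.\<close>
    case True
    then show ?thesis
      using abelian_frattini[OF True q exp] abelian_order[OF True q exp] by auto
  next
    case False
    interpret nonabelian_p_group_aut G p
    proof (rule nonabelian_p_group_autI[OF False q _ exp])
      fix \<sigma> \<tau> x
      assume "\<sigma> \<in> hom G G" "inj_on \<sigma> (carrier G)" "\<tau> \<in> hom G G" "inj_on \<tau> (carrier G)"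
        "x \<in> carrier G"
      then show "\<sigma> (\<tau> x) = \<tau> (\<sigma> x)" by (rule AutoGroup_commute[OF fin ab])
    qed
    show ?thesis using frattini_cases group_exponent_eq by simp
  qed
qed

end
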